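(* If a Banach function space $X(\mathbb{R}^n)$ satisfies the bounded $L^2$-approximation property, then $\mathcal{M}^0_{X(\mathbb{R}^n)}=\mathcal{M}_{X(\mathbb{R}^n)}\cap L^\infty(\mathbb{R}^n)$ and $\|a\|_{\mathcal{M}_{X(\mathbb{R}^n)}}=\|a\|_{\mathcal{M}^0_{X(\mathbb{R}^n)}}$ for all $a$ in this set.
   Context: Banach function spaces: let $\mathfrak{M}^+(\mathbb{R}^n)$ be the set of Lebesgue measurable functions on $\mathbb{R}^n$ with values in $[0,\infty]$. A Banach function norm is a map $\rho:\mathfrak{M}^+(\mathbb{R}^n)\to[0,\infty]$ such that for all $f,g,f_j\in\mathfrak{M}^+(\mathbb{R}^n)$, all constants $a\ge0$ and all measurable $E$: (A1) $\rho(f)=0\iff f=0$ a.e., $\rho(af)=a\rho(f)$, $\rho(f+g)\le\rho(f)+\rho(g)$; (A2) $0\le g\le f$ a.e. implies $\rho(g)\le\rho(f)$; (A3) $0\le f_j\uparrow f$ a.e. implies $\rho(f_j)\uparrow\rho(f)$; (A4) $|E|<\infty$ implies $\rho(\chi_E)<\infty$; (A5) $|E|<\infty$ implies $\int_E f\le C_E\rho(f)$ with $C_E\in(0,\infty)$ independent of $f$. $X(\mathbb{R}^n)$ is the set of measurable complex $f$ with $\rho(|f|)<\infty$, $\|f\|_{X(\mathbb{R}^n)}=\rho(|f|)$. Bounded $L^2$-approximation property: for every $u\in L^2(\mathbb{R}^n)\cap X(\mathbb{R}^n)$ there is a sequence $u_j\in C_0^\infty(\mathbb{R}^n)$ with $\|u-u_j\|_{L^2}\to0$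 and $\limsup_j\|u_j\|_{X(\mathbb{R}^n)}\le\|u\|_{X(\mathbb{R}^n)}$. Fourier multipliers: $(Fu)(\xi)=\int u(x)e^{-ix\xi}dx$. $\mathcal{M}_{X(\mathbb{R}^n)}$ is the set of $a\in S'(\mathbb{R}^n)$ with $\|a\|_{\mathcal{M}_{X(\mathbb{R}^n)}}:=\sup\{\|F^{-1}aFu\|_{X}/\|u\|_{X}: u\in (S(\mathbb{R}^n)\cap X(\mathbb{R}^n))\setminus\{0\}\}<\infty$ (Fourier transforms in the sense of $S$ and $S'$). $\mathcal{M}^0_{X(\mathbb{R}^n)}$ is the set of $a\in L^\infty(\mathbb{R}^n)$ with $\|a\|_{\mathcal{M}^0_{X(\mathbb{R}^n)}}:=\sup\{\|F^{-1}aFu\|_{X}/\|u\|_{X}: u\in (L^2(\mathbb{R}^n)\cap X(\mathbb{R}^n))\setminus\{0\}\}<\infty$, where $F^{\pm1}$ are the Fourier transforms on $L^2(\mathbb{R}^n)$. *)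

theory Defs
  imports "HOL-Analysis.Analysis"
begin

fun iter_partial :: "'a::euclidean_space list \<Rightarrow> ('a \<Rightarrow> complex) \<Rightarrow> 'a \<Rightarrow> complex" where
  "iter_partial [] f = f"
| "iter_partial (b # bs) f = (\<lambda>x. frechet_derivative (iter_partial bs f) (at x) b)"

definition smooth_fun :: "('a::euclidean_space \<Rightarrow> complex) \<Rightarrow> bool" where
  "smooth_fun f \<longleftrightarrow> (\<forall>bs. set bs \<subseteq> Basis \<longrightarrow> (\<forall>x. iter_partial bs f differentiable (at x)))"

definition schwartz :: "('a::euclidean_space \<Rightarrow> complex) \<Rightarrow> bool" where
  "schwartz f \<longleftrightarrow> smooth_fun f \<and>
     (\<forall>bs k. set bs \<subseteq> Basis \<longrightarrow>
        bounded (range (\<lambda>x. (1 + norm x) ^ k * norm (iter_partial bs f x))))"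

definition C0_infty :: "('a::euclidean_space \<Rightarrow> complex) \<Rightarrow> bool" where
  "C0_infty f \<longleftrightarrow> smooth_fun f \<and> compact (closure {x. f x \<noteq> 0})"

definition L2 :: "('a::euclidean_space \<Rightarrow> complex) \<Rightarrow> bool" where
  "L2 f \<longleftrightarrow> f \<in> borel_measurable lebesgue \<and> integrable lebesgue (\<lambda>x. (cmod (f x))\<^sup>2)"

definition L1 :: "('a::euclidean_space \<Rightarrow> complex) \<Rightarrow> bool" where
  "L1 f \<longleftrightarrow> integrable lebesgue f"

definition Linfty :: "('a::euclidean_space \<Rightarrow> complex) \<Rightarrow> bool" where
  "Linfty f \<longleftrightarrow> f \<in> borel_measurable lebesgue \<and> (\<exists>C. AE x in lebesgue. cmod (f x) \<le> C)"

definition L2dist2 :: "('a::euclidean_space \<Rightarrow> complex) \<Rightarrow> ('a \<Rightarrow> complex) \<Rightarrow> ennreal" where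
  "L2dist2 f g = (\<integral>\<^sup>+ x. ennreal ((cmod (f x - g x))\<^sup>2) \<partial>lebesgue)"

definition fourier :: "('a::euclidean_space \<Rightarrow> complex) \<Rightarrow> 'a \<Rightarrow> complex" where
  "fourier u \<xi> = (\<integral> x. u x * cis (- (x \<bullet> \<xi>)) \<partial>lebesgue)"

definition ifourier :: "('a::euclidean_space \<Rightarrow> complex) \<Rightarrow> 'a \<Rightarrow> complex" where
  "ifourier v x = complex_of_real (1 / (2 * pi) ^ DIM('a)) * (\<integral> \<xi>. v \<xi> * cis (x \<bullet> \<xi>) \<partial>lebesgue)"

text \<open>Fourier transforms on L^2 (Plancherel extension from L^1 \<inter> L^2); determined up to
  a.e. equality, which is all that matters below.\<close>
definition fourier_L2 :: "('a::euclidean_space \<Rightarrow> complex) \<Rightarrow> 'a \<Rightarrow> complex" where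
  "fourier_L2 u = (SOME g. L2 g \<and> (\<exists>\<phi>. (\<forall>j. L1 (\<phi> j) \<and> L2 (\<phi> j)) \<and>
      (\<lambda>j. L2dist2 (\<phi> j) u) \<longlonglongrightarrow> 0 \<and> (\<lambda>j. L2dist2 (fourier (\<phi> j)) g) \<longlonglongrightarrow> 0))"

definition ifourier_L2 :: "('a::euclidean_space \<Rightarrow> complex) \<Rightarrow> 'a \<Rightarrow> complex" where
  "ifourier_L2 v = (SOME g. L2 g \<and> (\<exists>\<phi>. (\<forall>j. L1 (\<phi> j) \<and> L2 (\<phi> j)) \<and>
      (\<lambda>j. L2dist2 (\<phi> j) v) \<longlonglongrightarrow> 0 \<and> (\<lambda>j. L2dist2 (ifourier (\<phi> j)) g) \<longlonglongrightarrow> 0))"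

definition banach_function_norm :: "(('a::euclidean_space \<Rightarrow> ennreal) \<Rightarrow> ennreal) \<Rightarrow> bool" where
  "banach_function_norm \<rho> \<longleftrightarrow>
    \<comment> \<open>(A1)\<close>
    (\<forall>f \<in> borel_measurable lebesgue. \<rho> f = 0 \<longleftrightarrow> (AE x in lebesgue. f x = 0)) \<and>
    (\<forall>f \<in> borel_measurable lebesgue. \<forall>a::real. a \<ge> 0 \<longrightarrow>
        \<rho> (\<lambda>x. ennreal a * f x) = ennreal a * \<rho> f) \<and>
    (\<forall>f \<in> borel_measurable lebesgue. \<forall>g \<in> borel_measurable lebesgue.
        \<rho> (\<lambda>x. f x + g x) \<le> \<rho> f + \<rho> g) \<and>
    \<comment> \<open>(A2)\<close>
    (\<forall>f \<in> borel_measurable lebesgue. \<forall>g \<in> borel_measurable lebesgue.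
        (AE x in lebesgue. g x \<le> f x) \<longrightarrow> \<rho> g \<le> \<rho> f) \<and>
    \<comment> \<open>(A3)\<close>
    (\<forall>fs f. (\<forall>j. fs j \<in> borel_measurable lebesgue) \<longrightarrow> f \<in> borel_measurable lebesgue \<longrightarrow>
        (AE x in lebesgue. incseq (\<lambda>j. fs j x) \<and> (\<lambda>j. fs j x) \<longlonglongrightarrow> f x) \<longrightarrow>
        incseq (\<lambda>j. \<rho> (fs j)) \<and> (\<lambda>j. \<rho> (fs j)) \<longlonglongrightarrow> \<rho> f) \<and>
    \<comment> \<open>(A4)\<close>
    (\<forall>E \<in> sets lebesgue. emeasure lebesgue E < \<infinity> \<longrightarrow> \<rho> (indicator E) < \<infinity>) \<and>
    \<comment> \<open>(A5)\<close>
    (\<forall>E \<in> sets lebesgue. emeasure lebesgue E < \<infinity> \<longrightarrow>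
        (\<exists>C::real. C > 0 \<and> (\<forall>f \<in> borel_measurable lebesgue.
            (\<integral>\<^sup>+ x \<in> E. f x \<partial>lebesgue) \<le> ennreal C * \<rho> f)))"

definition Xnorm :: "(('a::euclidean_space \<Rightarrow> ennreal) \<Rightarrow> ennreal) \<Rightarrow> ('a \<Rightarrow> complex) \<Rightarrow> ennreal" where
  "Xnorm \<rho> f = \<rho> (\<lambda>x. ennreal (cmod (f x)))"

definition inX :: "(('a::euclidean_space \<Rightarrow> ennreal) \<Rightarrow> ennreal) \<Rightarrow> ('a \<Rightarrow> complex) \<Rightarrow> bool" where
  "inX \<rho> f \<longleftrightarrow> f \<in> borel_measurable lebesgue \<and> Xnorm \<rho> f < \<infinity>"

definition bounded_L2_approx :: "(('a::euclidean_space \<Rightarrow> ennreal) \<Rightarrow> ennreal) \<Rightarrow> bool" where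
  "bounded_L2_approx \<rho> \<longleftrightarrow>
    (\<forall>u. L2 u \<and> inX \<rho> u \<longrightarrow>
      (\<exists>uj. (\<forall>j. C0_infty (uj j)) \<and> (\<lambda>j. L2dist2 u (uj j)) \<longlonglongrightarrow> 0 \<and>
            limsup (\<lambda>j. Xnorm \<rho> (uj j)) \<le> Xnorm \<rho> u))"

text \<open>Multiplier norm over Schwartz functions, for a bounded symbol a: here
  F^{-1}(a F u) is the inverse Fourier transform of the L^1 \<inter> L^2 function a F u,
  which is what the S'-transform is for such symbols.\<close>
definition mult_norm :: "(('a::euclidean_space \<Rightarrow> ennreal) \<Rightarrow> ennreal) \<Rightarrow> ('a \<Rightarrow> complex) \<Rightarrow> ennreal" where
  "mult_norm \<rho> a = (SUP u \<in> {u. schwartz u \<and> inX \<rho> u \<and> Xnorm \<rho> u \<noteq> 0}.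
      Xnorm \<rho> (ifourier (\<lambda>\<xi>. a \<xi> * fourier u \<xi>)) / Xnorm \<rho> u)"

definition mult0_norm :: "(('a::euclidean_space \<Rightarrow> ennreal) \<Rightarrow> ennreal) \<Rightarrow> ('a \<Rightarrow> complex) \<Rightarrow> ennreal" where
  "mult0_norm \<rho> a = (SUP u \<in> {u. L2 u \<and> inX \<rho> u \<and> Xnorm \<rho> u \<noteq> 0}.
      Xnorm \<rho> (ifourier_L2 (\<lambda>\<xi>. a \<xi> * fourier_L2 u \<xi>)) / Xnorm \<rho> u)"

definition mult_Linfty :: "(('a::euclidean_space \<Rightarrow> ennreal) \<Rightarrow> ennreal) \<Rightarrow> ('a \<Rightarrow> complex) set" where
  "mult_Linfty \<rho> = {a. Linfty a \<and> mult_norm \<rho> a < \<infinity>}"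

definition mult0 :: "(('a::euclidean_space \<Rightarrow> ennreal) \<Rightarrow> ennreal) \<Rightarrow> ('a \<Rightarrow> complex) set" where
  "mult0 \<rho> = {a. Linfty a \<and> mult0_norm \<rho> a < \<infinity>}"

end

theory Submission
  imports Defs "HOL-Probability.Characteristic_Functions"
begin

text \<open>
  The multiplier operator \<open>W u = F\<inverse>(a F u)\<close> is Lipschitz on \<open>L\<^sup>2\<close> because \<open>a\<close> is bounded, and on Schwartz
  functions it agrees almost everywhere with the operator defining the norm on \<open>M\<^sub>X\<close>. That norm is
  therefore a supremum over fewer functions. Conversely, given \<open>u\<close> in \<open>L\<^sup>2 \<inter> X\<close>, take the test functions
  \<open>u\<^sub>j\<close> of the approximation property. Along a subsequence \<open>W u\<^sub>j \<rightarrow> W u\<close> almost everywhere, and the Fatou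
  property of \<open>\<rho>\<close>, a consequence of (A2) and (A3), bounds the norm of \<open>W u\<close> by the lower limit of the
  norms of \<open>W u\<^sub>j\<close>, which are controlled by those of \<open>u\<^sub>j\<close>.

  Neither Fourier inversion nor Plancherel's identity is needed, only an \<open>L\<^sup>2\<close> bound for the Fourier
  transform on \<open>L\<^sup>1 \<inter> L\<^sup>2\<close>.
\<close>

subsection \<open>An $L^2$ bound for the Fourier transform\<close>

text \<open>\<open>fourier_L2\<close> and \<open>ifourier_L2\<close> are choices, so nothing is
  known about them until a witness exists. This forces the density of truncations and the
  completeness of L^2; afterwards every fact about them follows from a Lipschitz bound alone. That
  bound comes from weighting |F u|^2 with a Gaussian: the weight makes Fubini legitimate, and its
  transform is again a positive Gaussian, whose mass stays fixed while the weight flattens out. A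
  second obstacle is that \<open>mult_norm\<close> uses the integral \<open>ifourier\<close>, and
  the extension agrees with it on functions that are in both L^1 and L^2. Hence F u has to be
  integrable for Schwartz u, which is obtained from the decay that derivatives of u give to F u.
  Distances are kept as squares in \<open>ennreal\<close>; the factors 2, 4 and 16 below are the
  price, and they never reach the norms being compared, because Lipschitz constants on L^2 serve
  only to get convergence.\<close>

lemma
  fixes f :: "'a::euclidean_space \<Rightarrow> real \<Rightarrow> complex"
  assumes f: "\<And>b. b \<in> Basis \<Longrightarrow> integrable lborel (f b)"
  shows integrable_lborel_prod_Basis: "integrable lborel (\<lambda>x::'a. \<Prod>b\<in>Basis. f b (x \<bullet> b))" (is "integrable lborel ?F")
    and integral_lborel_prod_Basis:
      "integral\<^sup>L lborel (\<lambda>x::'a. \<Prod>b\<in>Basis. f b (x \<bullet> b)) = (\<Prod>b\<in>Basis. \<integral>t. f b t \<partial>lborel)"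
proof -
  interpret product_sigma_finite "\<lambda>_::'a. lborel :: real measure" ..
  note [measurable] = borel_measurable_integrable[OF f, simplified]
  have F[measurable]: "?F \<in> borel_measurable borel" by measurable
  let ?D = "distr (\<Pi>\<^sub>M b\<in>Basis. lborel) borel (\<lambda>f. \<Sum>b\<in>Basis. f b *\<^sub>R b) :: 'a measure"
  have D: "lborel = ?D" by (rule lborel_eq)
  have eq: "?F (\<Sum>b\<in>Basis. y b *\<^sub>R b) = (\<Prod>b\<in>Basis. f b (y b))" for y :: "'a \<Rightarrow> real"
    by (intro prod.cong refl) simp
  have "integrable ?D ?F"
    by (subst integrable_distr_eq) (simp_all only: eq, measurable, simp_all add: product_integrable_prod f)
  then show "integrable lborel ?F" by (subst D)
  have "integral\<^sup>L ?D ?F = (\<Prod>b\<in>Basis. \<integral>t. f b t \<partial>lborel)"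
    by (subst integral_distr) (simp_all only: eq, measurable, simp_all add: product_integral_prod f)
  then show "integral\<^sup>L lborel ?F = (\<Prod>b\<in>Basis. \<integral>t. f b t \<partial>lborel)" by (subst D)
qed

section \<open>Lebesgue measure: sigma-finiteness, measurability and changes of variables\<close>

lemma sigma_finite_lebesgue: "sigma_finite_measure (lebesgue :: 'a::euclidean_space measure)"
proof
  obtain A :: "'a set set" where A: "countable A" "A \<subseteq> sets lborel" "\<Union>A = space lborel"
    "\<forall>a\<in>A. emeasure lborel a \<noteq> \<infinity>"
    using lborel.sigma_finite_countable by blast
  then show "\<exists>A::'a set set. countable A \<and> A \<subseteq> sets lebesgue \<and> \<Union>A = space lebesgue \<and>
      (\<forall>a\<in>A. emeasure lebesgue a \<noteq> \<infinity>)"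
    by (intro exI[of _ A]) (auto simp: subset_iff)
qed

text \<open>The definitions integrate against the completed measure, so Fubini and Tonelli are set
  up for \<open>lebesgue\<close> itself and not for \<open>lborel\<close>.\<close>

interpretation lebesgue: sigma_finite_measure lebesgue
  by (rule sigma_finite_lebesgue)

interpretation lebesgue_pair: pair_sigma_finite lebesgue lebesgue ..

text \<open>Lets the measurability prover see factors such as
  \<open>cis (- (x \<bullet> \<xi>))\<close> as measurable over \<open>lebesgue\<close> and over its
  square.\<close>

lemma borel_measurable_ident_lebesgue [measurable]: "(\<lambda>x. x) \<in> measurable lebesgue borel"
  by (rule measurable_completion) simp

lemma measurable_cis [measurable (raw)]:
  "f \<in> borel_measurable M \<Longrightarrow> (\<lambda>x. cis (f x)) \<in> borel_measurable M"
  by (simp add: cis_conv_exp)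

lemma measurable_cnj [measurable (raw)]:
  "f \<in> borel_measurable M \<Longrightarrow> (\<lambda>x. cnj (f x)) \<in> borel_measurable M"
  by (rule borel_measurable_continuous_on[where f=cnj]) (auto intro: continuous_intros)

text \<open>For Borel functions the integrals over \<open>lborel\<close> and its completion agree,
  which reduces the claim to \<open>lborel_affine\<close>. One formula covers translations (s = 1),
  reflections (s = -1) and dilations.\<close>

lemma lebesgue_nn_integral_affine:
  fixes f :: "'a::euclidean_space \<Rightarrow> ennreal"
  assumes [measurable]: "f \<in> borel_measurable borel" and "s \<noteq> 0"
  shows "ennreal (\<bar>s\<bar> ^ DIM('a)) * (\<integral>\<^sup>+x. f (c + s *\<^sub>R x) \<partial>lebesgue) = (\<integral>\<^sup>+x. f x \<partial>lebesgue)"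
proof -
  have "(\<integral>\<^sup>+x. f x \<partial>lborel) = (\<integral>\<^sup>+x. f x \<partial>density (distr lborel borel (\<lambda>x. c + s *\<^sub>R x)) (\<lambda>_. ennreal (\<bar>s\<bar> ^ DIM('a))))"
    using lborel_affine[OF \<open>s \<noteq> 0\<close>, of c] by (simp add: ennreal_power)
  also have "\<dots> = ennreal (\<bar>s\<bar> ^ DIM('a)) * (\<integral>\<^sup>+x. f (c + s *\<^sub>R x) \<partial>lborel)"
    by (simp add: nn_integral_density nn_integral_distr nn_integral_cmult)
  finally show ?thesis
    by (simp add: nn_integral_completion)
qed

lemma lebesgue_integral_scaleR:
  fixes f :: "'a::euclidean_space \<Rightarrow> complex"
  assumes [measurable]: "f \<in> borel_measurable borel" and "s > 0"
  shows "(\<integral>x. f (s *\<^sub>R x) \<partial>lebesgue) = (\<integral>x. f x \<partial>lebesgue) /\<^sub>R s ^ DIM('a)"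
proof -
  have "(\<integral>x. f x \<partial>lborel) = (\<integral>x. f x \<partial>density (distr lborel borel (\<lambda>x. 0 + s *\<^sub>R x)) (\<lambda>_. ennreal (s ^ DIM('a))))"
    using lborel_affine[of s "0::'a"] \<open>s > 0\<close> by (simp add: ennreal_power)
  also have "\<dots> = s ^ DIM('a) *\<^sub>R (\<integral>x. f (s *\<^sub>R x) \<partial>lborel)"
    using \<open>s > 0\<close> by (simp add: integral_density integral_distr)
  finally show ?thesis
    using \<open>s > 0\<close> by (simp add: integral_completion)
qed

lemma lebesgue_integral_translation:
  fixes f :: "'a::euclidean_space \<Rightarrow> complex"
  assumes [measurable]: "f \<in> borel_measurable borel"
  shows "(\<integral>x. f (c + x) \<partial>lebesgue) = (\<integral>x. f x \<partial>lebesgue)"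
proof -
  have "(\<integral>x. f x \<partial>lborel) = (\<integral>x. f x \<partial>distr lborel borel ((+) c))"
    by (simp add: lborel_distr_plus)
  also have "\<dots> = (\<integral>x. f (c + x) \<partial>lborel)"
    by (simp add: integral_distr)
  finally show ?thesis
    by (simp add: integral_completion)
qed

section \<open>The Fourier integral on L^1 and a weighted L^2 bound\<close>

lemma integrable_mult_cis:
  fixes f :: "'a::euclidean_space \<Rightarrow> complex"
  assumes "integrable lebesgue f"
  shows "integrable lebesgue (\<lambda>x. f x * cis (- (x \<bullet> \<xi>)))"
  by (rule Bochner_Integration.integrable_bound[OF assms])
    (use borel_measurable_integrable[OF assms] in \<open>auto simp: norm_mult\<close>)

lemma fourier_measurable:
  assumes [measurable]: "u \<in> borel_measurable lebesgue"
  shows "fourier u \<in> borel_measurable lebesgue"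
  unfolding fourier_def[abs_def] by measurable

lemma norm_fourier_le:
  fixes u :: "'a::euclidean_space \<Rightarrow> complex"
  shows "cmod (fourier u \<xi>) \<le> (\<integral>x. cmod (u x) \<partial>lebesgue)"
proof -
  have "cmod (fourier u \<xi>) \<le> (\<integral>x. norm (u x * cis (- (x \<bullet> \<xi>))) \<partial>lebesgue)"
    unfolding fourier_def by (rule integral_norm_bound)
  then show ?thesis by (simp add: norm_mult)
qed

lemma fourier_diff:
  assumes "integrable lebesgue u" "integrable lebesgue v"
  shows "fourier (\<lambda>x. u x - v x) \<xi> = fourier u \<xi> - fourier v \<xi>"
  unfolding fourier_def using assms by (simp add: left_diff_distrib integrable_mult_cis)

text \<open>Fubini applies because the kernel has modulus one, so that the double integrand has
  modulus |u(x)| |h(\<xi>)|. The weighted bound below uses this formula twice.\<close>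

lemma fourier_multiplication_formula:
  fixes u h :: "'a::euclidean_space \<Rightarrow> complex"
  assumes u: "integrable lebesgue u" and h: "integrable lebesgue h"
  shows "(\<integral>\<xi>. fourier u \<xi> * h \<xi> \<partial>lebesgue) = (\<integral>x. u x * fourier h x \<partial>lebesgue)"
proof -
  note [measurable] = borel_measurable_integrable[OF u] borel_measurable_integrable[OF h]
  define f where "f = (\<lambda>x \<xi>. u x * cis (- (x \<bullet> \<xi>)) * h \<xi>)"
  have nrm: "norm (f x \<xi>) = cmod (u x) * cmod (h \<xi>)" for x \<xi>
    by (simp add: f_def norm_mult)
  have "integrable (lebesgue \<Otimes>\<^sub>M lebesgue) (case_prod f)"
  proof (rule lebesgue_pair.Fubini_integrable)
    show "case_prod f \<in> borel_measurable (lebesgue \<Otimes>\<^sub>M lebesgue)"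
      unfolding f_def by measurable
    show "integrable lebesgue (\<lambda>x. \<integral>y. norm (case (x, y) of (x, xa) \<Rightarrow> f x xa) \<partial>lebesgue)"
      using u by (simp add: nrm)
    show "AE x in lebesgue. integrable lebesgue (\<lambda>y. case (x, y) of (x, xa) \<Rightarrow> f x xa)"
    proof (rule AE_I2)
      fix x
      have "integrable lebesgue (\<lambda>y. cmod (u x) * cmod (h y))"
        using h by simp
      then show "integrable lebesgue (\<lambda>y. case (x, y) of (x, xa) \<Rightarrow> f x xa)"
        by (rule Bochner_Integration.integrable_bound) (auto simp: norm_mult f_def)
    qed
  qed
  from lebesgue_pair.Fubini_integral[OF this]
  have "(\<integral>\<xi>. (\<integral>x. f x \<xi> \<partial>lebesgue) \<partial>lebesgue) = (\<integral>x. (\<integral>\<xi>. f x \<xi> \<partial>lebesgue) \<partial>lebesgue)" .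
  moreover have "(\<integral>x. f x \<xi> \<partial>lebesgue) = fourier u \<xi> * h \<xi>" for \<xi>
    unfolding f_def fourier_def by simp
  moreover have "(\<integral>\<xi>. f x \<xi> \<partial>lebesgue) = u x * fourier h x" for x
    unfolding f_def fourier_def
    by (simp add: mult.assoc mult.commute[of "cis _"] inner_commute)
  ultimately show ?thesis by simp
qed

text \<open>The weighted integral equals \<open>\<integral>\<integral> u(x) cnj(u(y)) H(y - x)\<close>; AM-GM on \<open>|u(x)| |u(y)|\<close> and
  Tonelli finish.\<close>
lemma fourier_weighted_L2_bound:
  fixes u :: "'a::euclidean_space \<Rightarrow> complex" and K H :: "'a \<Rightarrow> real"
  assumes u: "integrable lebesgue u" and K: "integrable lebesgue K" and K0: "\<And>x. 0 \<le> K x"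
    and FK: "\<And>x. fourier (\<lambda>\<xi>. complex_of_real (K \<xi>)) x = of_real (H x)"
    and H[measurable]: "H \<in> borel_measurable borel" and H0: "\<And>x. 0 \<le> H x"
  shows "(\<integral>\<^sup>+\<xi>. ennreal ((cmod (fourier u \<xi>))\<^sup>2 * K \<xi>) \<partial>lebesgue)
    \<le> (\<integral>\<^sup>+x. ennreal (H x) \<partial>lebesgue) * (\<integral>\<^sup>+x. ennreal ((cmod (u x))\<^sup>2) \<partial>lebesgue)"
proof -
  note [measurable] = borel_measurable_integrable[OF u] borel_measurable_integrable[OF K]
    fourier_measurable[OF borel_measurable_integrable[OF u]]
  define B where "B = (\<integral>x. cmod (u x) \<partial>lebesgue)"
  have FB: "cmod (fourier u \<xi>) \<le> B" for \<xi>
    unfolding B_def by (rule norm_fourier_le)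
  have B0: "0 \<le> B" using FB[of 0] norm_ge_zero order_trans by blast
  \<comment> \<open>With this choice the integral of |F u|^2 K is that of F u times h, and the
    multiplication formula moves the transform from u to h.\<close>
  define h where "h = (\<lambda>\<xi>. K \<xi> * cnj (fourier u \<xi>))"
  have intBK: "integrable lebesgue (\<lambda>\<xi>. B * K \<xi>)" using K by simp
  have h: "integrable lebesgue h"
  proof (rule Bochner_Integration.integrable_bound[OF intBK])
    show "h \<in> borel_measurable lebesgue"
      unfolding h_def by measurable
    show "AE \<xi> in lebesgue. norm (h \<xi>) \<le> norm (B * K \<xi>)"
      by (auto simp: h_def norm_mult K0 B0 mult.commute[of B] intro!: mult_left_mono FB)
  qed
  have intB2K: "integrable lebesgue (\<lambda>\<xi>. B\<^sup>2 * K \<xi>)" using K by simp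
  have intg: "integrable lebesgue (\<lambda>\<xi>. (cmod (fourier u \<xi>))\<^sup>2 * K \<xi>)"
    by (rule Bochner_Integration.integrable_bound[OF intB2K])
      (auto simp: abs_mult K0 intro!: mult_mono power_mono FB)
  \<comment> \<open>Second use of the multiplication formula: modulating K by
    \<open>cis (\<xi> \<bullet> x)\<close> translates its transform, so F h is the conjugate of u
    correlated with H.\<close>
  have Fh: "fourier h x = cnj (\<integral>y. u y * of_real (H (y - x)) \<partial>lebesgue)" for x
  proof -
    have "fourier h x = (\<integral>\<xi>. cnj (fourier u \<xi> * (K \<xi> * cis (\<xi> \<bullet> x))) \<partial>lebesgue)"
      unfolding fourier_def[of h] by (simp add: h_def mult_ac cis_cnj)
    also have "\<dots> = cnj (\<integral>\<xi>. fourier u \<xi> * (K \<xi> * cis (\<xi> \<bullet> x)) \<partial>lebesgue)"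
      by (rule Bochner_Integration.integral_cnj)
    also have "(\<integral>\<xi>. fourier u \<xi> * (K \<xi> * cis (\<xi> \<bullet> x)) \<partial>lebesgue)
        = (\<integral>y. u y * fourier (\<lambda>\<xi>. K \<xi> * cis (\<xi> \<bullet> x)) y \<partial>lebesgue)"
    proof (rule fourier_multiplication_formula[OF u])
      show "integrable lebesgue (\<lambda>\<xi>. complex_of_real (K \<xi>) * cis (\<xi> \<bullet> x))"
        by (rule Bochner_Integration.integrable_bound[OF K]) (auto simp: norm_mult)
    qed
    also have "(\<lambda>y. fourier (\<lambda>\<xi>. K \<xi> * cis (\<xi> \<bullet> x)) y) = (\<lambda>y. of_real (H (y - x)))"
      unfolding FK[symmetric] fourier_def
      by (intro ext Bochner_Integration.integral_cong)
        (auto simp: cis_mult inner_diff_right mult.assoc)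
    finally show ?thesis .
  qed
  define N where "N = (\<integral>\<^sup>+x. ennreal ((cmod (u x))\<^sup>2) \<partial>lebesgue)"
  define I where "I = (\<integral>\<^sup>+x. ennreal (H x) \<partial>lebesgue)"
  have [measurable]: "H \<in> borel_measurable lebesgue"
    by (rule measurable_completion) simp
  have shift: "(\<integral>\<^sup>+y. ennreal (H (y - x)) \<partial>lebesgue) = I" for x
    using lebesgue_nn_integral_affine[of "\<lambda>x. ennreal (H x)" 1 "- x"] by (simp add: I_def)
  have refl: "(\<integral>\<^sup>+x. ennreal (H (y - x)) \<partial>lebesgue) = I" for y
    using lebesgue_nn_integral_affine[of "\<lambda>x. ennreal (H x)" "-1" y] by (simp add: I_def)
  have uFh: "ennreal (cmod (u x * fourier h x)) \<le>
      (\<integral>\<^sup>+y. ennreal (1/2) * (ennreal ((cmod (u x))\<^sup>2) * ennreal (H (y - x))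
         + ennreal ((cmod (u y))\<^sup>2) * ennreal (H (y - x))) \<partial>lebesgue)" (is "_ \<le> ?R") for x
  proof -
    \<comment> \<open>The function y to u(y) H(y - x) is not known to be integrable. Where it is
      not, the Bochner integral has the default value 0 and the inequality is trivial.\<close>
    have 1: "ennreal (cmod (\<integral>y. u y * of_real (H (y - x)) \<partial>lebesgue))
       \<le> (\<integral>\<^sup>+y. norm (u y * of_real (H (y - x))) \<partial>lebesgue)"
      by (cases "integrable lebesgue (\<lambda>y. u y * of_real (H (y - x)))")
        (auto simp: integral_norm_bound_ennreal not_integrable_integral_eq)
    have "ennreal (cmod (u x * fourier h x))
        = ennreal (cmod (u x)) * ennreal (cmod (\<integral>y. u y * of_real (H (y - x)) \<partial>lebesgue))"
      by (simp add: Fh norm_mult ennreal_mult del: complex_cnj_mult)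
    also have "\<dots> \<le> ennreal (cmod (u x)) * (\<integral>\<^sup>+y. norm (u y * of_real (H (y - x))) \<partial>lebesgue)"
      by (intro mult_left_mono 1) auto
    also have "\<dots> = (\<integral>\<^sup>+y. ennreal (cmod (u x)) * norm (u y * of_real (H (y - x))) \<partial>lebesgue)"
      by (rule nn_integral_cmult[symmetric]) measurable
    also have "\<dots> \<le> ?R"
    proof (rule nn_integral_mono)
      fix y
      have "2 * (cmod (u x) * cmod (u y)) \<le> (cmod (u x))\<^sup>2 + (cmod (u y))\<^sup>2"
        using sum_squares_bound[of "cmod (u x)" "cmod (u y)"] by (simp add: mult.assoc)
      then have "cmod (u x) * cmod (u y) * H (y - x) \<le> 1/2 * ((cmod (u x))\<^sup>2 + (cmod (u y))\<^sup>2) * H (y - x)"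
        by (intro mult_right_mono H0) simp
      then have "ennreal (cmod (u x) * cmod (u y) * H (y - x))
          \<le> ennreal (1/2 * ((cmod (u x))\<^sup>2 * H (y - x) + (cmod (u y))\<^sup>2 * H (y - x)))"
        by (intro ennreal_leI) (simp add: algebra_simps)
      also have "\<dots> = ennreal (1/2) * (ennreal ((cmod (u x))\<^sup>2) * ennreal (H (y - x))
         + ennreal ((cmod (u y))\<^sup>2) * ennreal (H (y - x)))"
        by (subst ennreal_mult', simp, subst ennreal_plus) (simp_all only: H0 ennreal_mult' mult_nonneg_nonneg zero_le_power2)
      finally show "ennreal (cmod (u x)) * norm (u y * of_real (H (y - x))) \<le> \<dots>"
        by (simp add: norm_mult H0 ennreal_mult'[symmetric] mult.assoc)
    qed
    finally show ?thesis .
  qed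
  \<comment> \<open>The half of the AM-GM bound that carries |u(y)|^2 is integrated over x first;
    the reflected translate of H then contributes I for every y.\<close>
  have swap: "(\<integral>\<^sup>+x. (\<integral>\<^sup>+y. ennreal ((cmod (u y))\<^sup>2) * ennreal (H (y - x)) \<partial>lebesgue) \<partial>lebesgue) = N * I"
  proof -
    have "(\<integral>\<^sup>+x. (\<integral>\<^sup>+y. ennreal ((cmod (u y))\<^sup>2) * ennreal (H (y - x)) \<partial>lebesgue) \<partial>lebesgue)
      = (\<integral>\<^sup>+y. (\<integral>\<^sup>+x. ennreal ((cmod (u y))\<^sup>2) * ennreal (H (y - x)) \<partial>lebesgue) \<partial>lebesgue)"
      by (rule lebesgue_pair.Fubini') measurable
    also have "\<dots> = N * I"
      by (simp add: nn_integral_cmult refl nn_integral_multc N_def)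
    finally show ?thesis .
  qed
  have "ennreal (\<integral>\<xi>. (cmod (fourier u \<xi>))\<^sup>2 * K \<xi> \<partial>lebesgue)
      = ennreal (cmod (complex_of_real (\<integral>\<xi>. (cmod (fourier u \<xi>))\<^sup>2 * K \<xi> \<partial>lebesgue)))"
    by (simp add: K0)
  also have "complex_of_real (\<integral>\<xi>. (cmod (fourier u \<xi>))\<^sup>2 * K \<xi> \<partial>lebesgue)
      = (\<integral>\<xi>. fourier u \<xi> * h \<xi> \<partial>lebesgue)"
    unfolding integral_complex_of_real[symmetric] h_def
    by (intro Bochner_Integration.integral_cong)
      (auto simp: complex_norm_square mult_ac simp del: of_real_power)
  also have "\<dots> = (\<integral>x. u x * fourier h x \<partial>lebesgue)"
    by (rule fourier_multiplication_formula[OF u h])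
  also have "ennreal (cmod \<dots>) \<le> (\<integral>\<^sup>+x. ennreal (cmod (u x * fourier h x)) \<partial>lebesgue)"
    by (cases "integrable lebesgue (\<lambda>x. u x * fourier h x)")
      (auto simp: integral_norm_bound_ennreal not_integrable_integral_eq)
  also have "\<dots> \<le> (\<integral>\<^sup>+x. (\<integral>\<^sup>+y. ennreal (1/2) * (ennreal ((cmod (u x))\<^sup>2) * ennreal (H (y - x))
         + ennreal ((cmod (u y))\<^sup>2) * ennreal (H (y - x))) \<partial>lebesgue) \<partial>lebesgue)"
    by (intro nn_integral_mono uFh)
  also have "\<dots> = ennreal (1/2) * (N * I + N * I)"
    by (simp add: nn_integral_cmult nn_integral_add shift swap nn_integral_multc N_def[symmetric]
        lebesgue.borel_measurable_nn_integral)
  also have "\<dots> = I * N"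
  proof -
    have "ennreal (1/2) * 2 = 1"
      using ennreal_mult'[of 2 "1/2"] by (simp add: mult.commute)
    then show ?thesis
      by (simp only: mult_2[symmetric] mult.assoc[symmetric] mult_1_left mult.commute[of I])
  qed
  finally show ?thesis
    using intg K0 unfolding I_def N_def by (subst nn_integral_eq_integral) auto
qed


section \<open>Gaussians and the unweighted L^2 bound\<close>

lemma cis_sum: "finite A \<Longrightarrow> cis (\<Sum>i\<in>A. f i) = (\<Prod>i\<in>A. cis (f i))"
  by (induction A rule: finite_induct) (auto simp: cis_mult[symmetric])

text \<open>This is (2 pi)^(-n/2) exp(-|x|^2 / 2). The product form lets its Fourier transform split
  into characteristic functions of the standard normal law.\<close>

definition gauss :: "'a::euclidean_space \<Rightarrow> real" where
  "gauss x = (\<Prod>b\<in>Basis. std_normal_density (x \<bullet> b))"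

lemma continuous_gauss: "continuous_on UNIV (gauss :: 'a::euclidean_space \<Rightarrow> real)"
  unfolding gauss_def normal_density_def by (intro continuous_intros) auto

lemma gauss_measurable [measurable]: "gauss \<in> borel_measurable borel"
  by (rule borel_measurable_continuous_onI[OF continuous_gauss])

lemma gauss_pos: "gauss x > 0"
  unfolding gauss_def by (intro prod_pos) (simp add: normal_density_pos)

lemma integrable_std_normal_mult_cis:
  "integrable lborel (\<lambda>t. complex_of_real (std_normal_density t) * cis (- (s * t)))"
proof (rule Bochner_Integration.integrable_bound)
  show "integrable lborel std_normal_density" by simp
qed (auto simp: norm_mult)

lemma integral_std_normal_mult_cis:
  "(\<integral>t. complex_of_real (std_normal_density t) * cis (- (s * t)) \<partial>lborel) = exp (- s\<^sup>2 / 2)"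
proof -
  have "char std_normal_distribution (- s) = exp (- s\<^sup>2 / 2)"
    by (simp add: char_std_normal_distribution)
  then show ?thesis
    unfolding char_def
    by (subst (asm) integral_density) (auto simp: cis_conv_exp scaleR_conv_of_real)
qed

lemma integrable_gauss: "integrable lebesgue (gauss :: 'a::euclidean_space \<Rightarrow> real)"
proof -
  have "integrable lborel (\<lambda>x::'a. \<Prod>b\<in>Basis. complex_of_real (std_normal_density (x \<bullet> b)))"
    by (rule integrable_lborel_prod_Basis) simp
  then have "integrable lborel (\<lambda>x::'a. complex_of_real (gauss x))"
    by (simp add: gauss_def)
  from integrable_norm[OF this] have "integrable lborel (\<lambda>x::'a. \<bar>gauss x\<bar>)" by simp
  then show ?thesis
    by (simp only: abs_of_pos[OF gauss_pos]) (simp add: integrable_completion)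
qed

text \<open>Each coordinate contributes exp(-t^2 / 2), which is sqrt(2 pi) times the normal density.
  So the Gaussian qualifies as a weight: it and its transform are both nonnegative and
  integrable.\<close>

lemma fourier_gauss:
  fixes x :: "'a::euclidean_space"
  shows "fourier (\<lambda>\<xi>. complex_of_real (gauss \<xi>)) x = of_real (sqrt (2 * pi) ^ DIM('a) * gauss x)"
proof -
  have "fourier (\<lambda>\<xi>. complex_of_real (gauss \<xi>)) x
      = (\<integral>\<xi>. (\<Prod>b\<in>Basis. complex_of_real (std_normal_density (\<xi> \<bullet> b)) * cis (- ((x \<bullet> b) * (\<xi> \<bullet> b)))) \<partial>lborel)"
    unfolding fourier_def
    by (subst integral_completion)
      (auto simp: gauss_def prod.distrib cis_sum[symmetric] sum_negf[symmetric]
        euclidean_inner[of _ x] mult.commute)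
  also have "\<dots> = (\<Prod>b\<in>Basis. complex_of_real (exp (- (x \<bullet> b)\<^sup>2 / 2)))"
    by (subst integral_lborel_prod_Basis)
      (auto simp only: integrable_std_normal_mult_cis integral_std_normal_mult_cis)
  also have "\<dots> = of_real (\<Prod>b\<in>Basis. sqrt (2 * pi) * std_normal_density (x \<bullet> b))"
    by (simp add: std_normal_density_def)
  finally show ?thesis
    by (simp add: prod.distrib gauss_def)
qed

text \<open>The weights \<open>gauss (\<xi> / k)\<close> tend to the constant \<open>gauss 0\<close>, while the \<open>L\<^sup>1\<close> norms of their Fourier
  transforms do not depend on \<open>k\<close>.\<close>
lemma fourier_L2_bound:
  fixes u :: "'a::euclidean_space \<Rightarrow> complex"
  assumes u: "L1 u"
  shows "ennreal (gauss (0::'a)) * (\<integral>\<^sup>+\<xi>. ennreal ((cmod (fourier u \<xi>))\<^sup>2) \<partial>lebesgue)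
    \<le> (\<integral>\<^sup>+x. ennreal (sqrt (2 * pi) ^ DIM('a) * gauss (x::'a)) \<partial>lebesgue)
        * (\<integral>\<^sup>+x. ennreal ((cmod (u x))\<^sup>2) \<partial>lebesgue)" (is "_ \<le> ?C * ?N")
proof -
  have u: "integrable lebesgue u" using u by (simp add: L1_def)
  have [measurable]: "fourier u \<in> borel_measurable lebesgue"
    using u by (auto intro!: fourier_measurable)
  have [measurable]: "gauss \<in> borel_measurable (lebesgue :: 'a measure)"
    by (rule measurable_completion) simp
  define K :: "nat \<Rightarrow> 'a \<Rightarrow> real" where "K k \<xi> = gauss (\<xi> /\<^sub>R Suc k)" for k \<xi>
  have [measurable]: "K k \<in> borel_measurable borel" for k
    unfolding K_def by measurable
  have [measurable]: "K k \<in> borel_measurable lebesgue" for k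
    by (rule measurable_completion) simp
  have bound: "(\<integral>\<^sup>+\<xi>. ennreal ((cmod (fourier u \<xi>))\<^sup>2 * K k \<xi>) \<partial>lebesgue) \<le> ?C * ?N" for k
  proof -
    define s where "s = real (Suc k)"
    have s: "s > 0" by (simp add: s_def)
    \<comment> \<open>The scaling rule: dilating the weight by s turns its transform g into s^n g(s
      x).\<close>
    define H :: "'a \<Rightarrow> real" where "H x = s ^ DIM('a) * (sqrt (2 * pi) ^ DIM('a) * gauss (s *\<^sub>R x))" for x
    have Hm[measurable]: "H \<in> borel_measurable borel" unfolding H_def by measurable
    have intK: "integrable lebesgue (K k)"
    proof -
      have "ennreal (inverse s ^ DIM('a)) * (\<integral>\<^sup>+x. ennreal (K k x) \<partial>lebesgue)
          = (\<integral>\<^sup>+x. ennreal (gauss (x::'a)) \<partial>lebesgue)"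
        using lebesgue_nn_integral_affine[of "\<lambda>x::'a. ennreal (gauss x)" "inverse s" 0] s
        by (simp add: K_def s_def)
      also have "\<dots> < \<infinity>"
        using integrable_gauss[where 'a='a] gauss_pos[where 'a='a]
        by (simp add: integrable_iff_bounded less_imp_le)
      finally show ?thesis
        using s gauss_pos[where 'a='a]
        by (auto simp: integrable_iff_bounded ennreal_mult_less_top K_def less_imp_le abs_of_pos)
    qed
    have FK: "fourier (\<lambda>\<xi>. complex_of_real (K k \<xi>)) x = of_real (H x)" for x
    proof -
      have "(\<integral>\<xi>. complex_of_real (gauss (inverse s *\<^sub>R \<xi>)) * cis (- ((inverse s *\<^sub>R \<xi>) \<bullet> (s *\<^sub>R x))) \<partial>lebesgue)
        = fourier (\<lambda>\<xi>. complex_of_real (gauss \<xi>)) (s *\<^sub>R x) /\<^sub>R inverse s ^ DIM('a)"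
        unfolding fourier_def using s
        by (subst lebesgue_integral_scaleR[where s="inverse s", symmetric]) auto
      moreover have "K k \<xi> = gauss (inverse s *\<^sub>R \<xi>)" for \<xi>
        by (simp add: K_def s_def)
      moreover have "(inverse s *\<^sub>R \<xi>) \<bullet> (s *\<^sub>R x) = \<xi> \<bullet> x" for \<xi>
        using s by simp
      ultimately have "fourier (\<lambda>\<xi>. complex_of_real (K k \<xi>)) x
          = of_real (sqrt (2 * pi) ^ DIM('a) * gauss (s *\<^sub>R x)) /\<^sub>R inverse s ^ DIM('a)"
        unfolding fourier_gauss by (simp only: fourier_def)
      then show ?thesis
        using s
        by (simp only: fourier_def H_def)
          (simp add: scaleR_conv_of_real power_inverse)
    qed
    have "(\<integral>\<^sup>+x. ennreal (H x) \<partial>lebesgue) = ?C"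
      using lebesgue_nn_integral_affine[of "\<lambda>x::'a. ennreal (sqrt (2 * pi) ^ DIM('a) * gauss x)" s 0] s
      by (simp add: H_def ennreal_mult'[of "s ^ _"] nn_integral_cmult)
    moreover have "K k x \<ge> 0" "H x \<ge> 0" for x
      using s by (auto simp: K_def H_def less_imp_le gauss_pos)
    ultimately show ?thesis
      using fourier_weighted_L2_bound[OF u intK _ FK Hm] by simp
  qed
  \<comment> \<open>The weights converge pointwise to \<open>gauss 0\<close> by continuity, so the
    liminf inside is a true limit and Fatou's lemma transfers the uniform bound.\<close>
  have "ennreal (gauss (0::'a)) * (\<integral>\<^sup>+\<xi>. ennreal ((cmod (fourier u \<xi>))\<^sup>2) \<partial>lebesgue)
     = (\<integral>\<^sup>+\<xi>. liminf (\<lambda>k. ennreal ((cmod (fourier u \<xi>))\<^sup>2 * K k \<xi>)) \<partial>lebesgue)"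
  proof (subst nn_integral_cmult[symmetric])
    have "liminf (\<lambda>k. ennreal ((cmod (fourier u \<xi>))\<^sup>2 * K k \<xi>)) = ennreal (gauss (0::'a)) * ennreal ((cmod (fourier u \<xi>))\<^sup>2)" for \<xi>
    proof -
      have "isCont gauss (0::'a)"
        using continuous_gauss[where 'a='a] by (simp add: continuous_on_eq_continuous_at)
      moreover have "(\<lambda>k. \<xi> /\<^sub>R Suc k) \<longlonglongrightarrow> 0"
        using tendsto_scaleR[OF LIMSEQ_inverse_real_of_nat tendsto_const[of \<xi>]] by simp
      ultimately have "(\<lambda>k. K k \<xi>) \<longlonglongrightarrow> gauss (0::'a)"
        unfolding K_def by (rule isCont_tendsto_compose)
      then have "(\<lambda>k. ennreal ((cmod (fourier u \<xi>))\<^sup>2 * K k \<xi>)) \<longlonglongrightarrow> ennreal ((cmod (fourier u \<xi>))\<^sup>2 * gauss (0::'a))"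
        by (intro tendsto_intros)
      from lim_imp_Liminf[OF _ this] show ?thesis
        by (simp add: ennreal_mult' gauss_pos less_imp_le mult.commute)
    qed
    then show "(\<integral>\<^sup>+\<xi>. ennreal (gauss (0::'a)) * ennreal ((cmod (fourier u \<xi>))\<^sup>2) \<partial>lebesgue)
      = (\<integral>\<^sup>+\<xi>. liminf (\<lambda>k. ennreal ((cmod (fourier u \<xi>))\<^sup>2 * K k \<xi>)) \<partial>lebesgue)"
      by simp
  qed measurable
  also have "\<dots> \<le> liminf (\<lambda>k. \<integral>\<^sup>+\<xi>. ennreal ((cmod (fourier u \<xi>))\<^sup>2 * K k \<xi>) \<partial>lebesgue)"
    by (rule nn_integral_liminf) measurable
  also have "\<dots> \<le> limsup (\<lambda>k. \<integral>\<^sup>+\<xi>. ennreal ((cmod (fourier u \<xi>))\<^sup>2 * K k \<xi>) \<partial>lebesgue)"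
    by (rule Liminf_le_Limsup) simp
  also have "\<dots> \<le> ?C * ?N"
    by (rule Limsup_bounded) (simp add: bound)
  finally show ?thesis .
qed

text \<open>Kept as a rule, this makes the measurability prover reduce goals over \<open>borel\<close> to false ones over
  \<open>lebesgue\<close>.\<close>
declare borel_measurable_ident_lebesgue [measurable del]

subsection \<open>Extension of bounded operators to $L^2$\<close>

lemma norm_diff_square_le:
  fixes a b c :: complex
  shows "(cmod (a - c))\<^sup>2 \<le> 2 * (cmod (a - b))\<^sup>2 + 2 * (cmod (b - c))\<^sup>2"
proof -
  have "(cmod (a - c))\<^sup>2 \<le> (cmod (a - b) + cmod (b - c))\<^sup>2"
    using norm_triangle_ineq[of "a - b" "b - c"] by (intro power_mono) auto
  also have "\<dots> \<le> 2 * (cmod (a - b))\<^sup>2 + 2 * (cmod (b - c))\<^sup>2"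
    using sum_squares_bound[of "cmod (a - b)" "cmod (b - c)"] by (simp add: power2_sum)
  finally show ?thesis .
qed

lemma L2_measurable: "L2 f \<Longrightarrow> f \<in> borel_measurable lebesgue"
  by (simp add: L2_def)

lemma L2_iff: "L2 f \<longleftrightarrow> f \<in> borel_measurable lebesgue \<and> L2dist2 f (\<lambda>_. 0) < \<infinity>"
  unfolding L2_def L2dist2_def
  by (auto simp: integrable_iff_bounded)

lemma L2dist2_commute: "L2dist2 f g = L2dist2 g f"
  by (simp add: L2dist2_def norm_minus_commute)

text \<open>\<open>L2dist2\<close> is the square of the distance, so the triangle inequality costs a
  factor 2, from (s + t)^2 \<le> 2 s^2 + 2 t^2. It holds in \<open>ennreal\<close> also when
  distances are infinite.\<close>

lemma L2dist2_triangle: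
  assumes [measurable]: "f \<in> borel_measurable lebesgue" "g \<in> borel_measurable lebesgue"
    "h \<in> borel_measurable lebesgue"
  shows "L2dist2 f h \<le> 2 * L2dist2 f g + 2 * L2dist2 g h"
proof -
  have "L2dist2 f h \<le> (\<integral>\<^sup>+x. 2 * ennreal ((cmod (f x - g x))\<^sup>2) + 2 * ennreal ((cmod (g x - h x))\<^sup>2) \<partial>lebesgue)"
    unfolding L2dist2_def
  proof (rule nn_integral_mono)
    fix x
    show "ennreal ((cmod (f x - h x))\<^sup>2) \<le> 2 * ennreal ((cmod (f x - g x))\<^sup>2) + 2 * ennreal ((cmod (g x - h x))\<^sup>2)"
      using ennreal_leI[OF norm_diff_square_le[of "f x" "h x" "g x"]]
      by (simp add: ennreal_mult)
  qed
  also have "\<dots> = 2 * L2dist2 f g + 2 * L2dist2 g h"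
    unfolding L2dist2_def by (simp add: nn_integral_add nn_integral_cmult)
  finally show ?thesis .
qed

lemma L2dist2_eq_0_iff:
  assumes [measurable]: "f \<in> borel_measurable lebesgue" "g \<in> borel_measurable lebesgue"
  shows "L2dist2 f g = 0 \<longleftrightarrow> (AE x in lebesgue. f x = g x)"
  unfolding L2dist2_def by (subst nn_integral_0_iff_AE) auto

lemma L2dist2_finite: "L2 f \<Longrightarrow> L2 g \<Longrightarrow> L2dist2 f g < \<infinity>"
  using L2dist2_triangle[of f "\<lambda>_. 0" g] L2dist2_commute[of g "\<lambda>_. 0"]
  by (auto simp: L2_iff ennreal_mult_less_top intro: le_less_trans)

lemma L2_transfer:
  assumes "L2 f" "g \<in> borel_measurable lebesgue" "L2dist2 g f < \<infinity>"
  shows "L2 g"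
  using L2dist2_triangle[of g f "\<lambda>_. 0"] assms
  by (auto simp: L2_iff ennreal_mult_less_top intro: le_less_trans)

text \<open>L^2 convergence says that |f_j - g|^2 tends to 0 in L^1, and an L^1 null sequence has a
  subsequence tending to 0 almost everywhere.\<close>

lemma L2_AE_subseq:
  assumes f: "\<And>j. L2 (f j)" and g: "L2 g" and lim: "(\<lambda>j. L2dist2 (f j) g) \<longlonglongrightarrow> 0"
  obtains r :: "nat \<Rightarrow> nat" where "strict_mono r" "AE x in lebesgue. (\<lambda>k. f (r k) x) \<longlonglongrightarrow> g x"
proof -
  note [measurable] = L2_measurable[OF f] L2_measurable[OF g]
  let ?u = "\<lambda>j x. (cmod (f j x - g x))\<^sup>2"
  have int: "integrable lebesgue (?u j)" for j
    using L2dist2_finite[OF f g] by (auto simp: integrable_iff_bounded L2dist2_def)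
  have "L2dist2 (f j) g = ennreal (\<integral>x. ?u j x \<partial>lebesgue)" for j
    unfolding L2dist2_def using int by (intro nn_integral_eq_integral) auto
  with lim have "(\<lambda>j. ennreal (\<integral>x. ?u j x \<partial>lebesgue)) \<longlonglongrightarrow> ennreal 0"
    by simp
  then have "(\<lambda>j. \<integral>x. ?u j x \<partial>lebesgue) \<longlonglongrightarrow> 0"
    by (subst (asm) tendsto_ennreal_iff) auto
  then have "(\<lambda>j. \<integral>x. norm (?u j x) \<partial>lebesgue) \<longlonglongrightarrow> 0"
    by simp
  from tendsto_L1_AE_subseq[OF int this] obtain r where r: "strict_mono r"
    "AE x in lebesgue. (\<lambda>k. ?u (r k) x) \<longlonglongrightarrow> 0" by auto
  from r(2) have "AE x in lebesgue. (\<lambda>k. f (r k) x) \<longlonglongrightarrow> g x"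
  proof eventually_elim
    case (elim x)
    have "(\<lambda>k. sqrt (?u (r k) x)) \<longlonglongrightarrow> sqrt 0"
      by (intro tendsto_real_sqrt elim)
    then show ?case
      by (simp add: tendsto_norm_zero_iff LIM_zero_iff)
  qed
  with r(1) show ?thesis by (rule that)
qed

text \<open>Weighting the squared increments of a fast Cauchy subsequence by \<open>2 ^ k\<close> makes the
  increments geometrically small almost everywhere, so no Minkowski inequality is needed.\<close>
lemma L2_complete:
  fixes g :: "nat \<Rightarrow> 'a::euclidean_space \<Rightarrow> complex"
  assumes g: "\<And>j. L2 (g j)"
    and Cauchy: "\<And>e. e > 0 \<Longrightarrow> \<exists>N. \<forall>m\<ge>N. \<forall>n\<ge>N. L2dist2 (g m) (g n) \<le> ennreal e"
  obtains h where "L2 h" "(\<lambda>j. L2dist2 (g j) h) \<longlonglongrightarrow> 0"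
proof -
  note gm[measurable] = L2_measurable[OF g]
  \<comment> \<open>The rate (1/4)^k is chosen so that the weight 2^k still leaves the summable
    (1/2)^k.\<close>
  have "\<exists>N. \<forall>m\<ge>N. \<forall>n\<ge>N. L2dist2 (g m) (g n) \<le> ennreal ((1/4) ^ k)" for k
    by (rule Cauchy) simp
  then obtain N where N: "\<And>k m n. m \<ge> N k \<Longrightarrow> n \<ge> N k \<Longrightarrow> L2dist2 (g m) (g n) \<le> ennreal ((1/4) ^ k)"
    by metis
  \<comment> \<open>The sum puts \<open>r k\<close> beyond \<open>N k\<close> and makes r monotone;
    the extra k makes the indices tend to infinity.\<close>
  define r where "r k = (\<Sum>i\<le>k. N i) + k" for k
  have r_ge: "r k \<ge> N k" "r k \<ge> k" for k
    using member_le_sum[of k "{..k}" N] by (auto simp: r_def)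
  have r_Suc: "r (Suc k) \<ge> r k" for k by (simp add: r_def)
  define d where "d k x = 2 ^ k * (cmod (g (r (Suc k)) x - g (r k) x))\<^sup>2" for k x
  have [measurable]: "d k \<in> borel_measurable lebesgue" for k
    unfolding d_def by measurable
  have "(\<integral>\<^sup>+x. ennreal (d k x) \<partial>lebesgue) \<le> ennreal ((1/2) ^ k)" for k
  proof -
    have "(\<integral>\<^sup>+x. ennreal (d k x) \<partial>lebesgue) = ennreal (2 ^ k) * L2dist2 (g (r (Suc k))) (g (r k))"
      unfolding d_def L2dist2_def by (simp add: ennreal_mult' nn_integral_cmult)
    also have "\<dots> \<le> ennreal (2 ^ k) * ennreal ((1/4) ^ k)"
      using r_Suc[of k] r_ge[of k] by (intro mult_left_mono N) auto
    also have "\<dots> = ennreal (2 ^ k * (1/4) ^ k)"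
      by (rule ennreal_mult'[symmetric]) simp
    also have "2 ^ k * (1/4) ^ k = (1/2 :: real) ^ k"
      by (simp flip: power_mult_distrib)
    finally show ?thesis .
  qed
  then have "(\<integral>\<^sup>+x. (\<Sum>k. ennreal (d k x)) \<partial>lebesgue) \<le> (\<Sum>k. ennreal ((1/2) ^ k))"
    by (subst nn_integral_suminf) (auto intro!: suminf_le)
  also have "\<dots> < \<infinity>"
    by (subst suminf_ennreal_eq[OF _ geometric_sums]) auto
  finally have "AE x in lebesgue. (\<Sum>k. ennreal (d k x)) \<noteq> \<infinity>"
    by (intro nn_integral_noteq_infinite) auto
  then have conv: "AE x in lebesgue. convergent (\<lambda>k. g (r k) x)"
  proof eventually_elim
    case (elim x)
    have "summable (\<lambda>k. d k x)"
      using elim by (intro summable_suminf_not_top) (auto simp: d_def)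
    then have "(\<lambda>k. d k x) \<longlonglongrightarrow> 0" by (rule summable_LIMSEQ_zero)
    then obtain C where C: "\<And>k. \<bar>d k x\<bar> \<le> C"
      using convergent_imp_Bseq[of "\<lambda>k. d k x"] unfolding convergent_def Bseq_def by auto
    have bound: "cmod (g (r (Suc k)) x - g (r k) x) \<le> sqrt C * (1 / sqrt 2) ^ k" for k
    proof -
      have "(cmod (g (r (Suc k)) x - g (r k) x))\<^sup>2 = d k x / 2 ^ k"
        by (simp add: d_def)
      also have "\<dots> \<le> C / 2 ^ k"
        using C[of k] by (intro divide_right_mono) auto
      finally have "sqrt ((cmod (g (r (Suc k)) x - g (r k) x))\<^sup>2) \<le> sqrt (C / 2 ^ k)"
        by (rule real_sqrt_le_mono)
      then show ?thesis
        by (simp add: real_sqrt_divide real_sqrt_power power_divide)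
    qed
    have "summable (\<lambda>k. sqrt C * (1 / sqrt 2) ^ k)"
      by (intro summable_mult summable_geometric) simp
    then have "summable (\<lambda>k. g (r (Suc k)) x - g (r k) x)"
      by (rule summable_comparison_test'[where N=0]) (rule bound)
    then have "convergent (\<lambda>n. \<Sum>k<n. g (r (Suc k)) x - g (r k) x)"
      by (simp add: summable_iff_convergent)
    then have "convergent (\<lambda>n. g (r n) x - g (r 0) x)"
      by (subst (asm) sum_lessThan_telescope[where f="\<lambda>k. g (r k) x"])
    from convergent_add[OF this convergent_const[of "g (r 0) x"]] show ?case
      by simp
  qed
  \<comment> \<open>Where the subsequence diverges, \<open>lim\<close> is an unspecified value; by
    \<open>conv\<close> this happens only on a null set.\<close>
  define h where "h x = lim (\<lambda>k. g (r k) x)" for x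
  have hm[measurable]: "h \<in> borel_measurable lebesgue"
    unfolding h_def by measurable
  \<comment> \<open>Fatou's lemma lets the second index run to infinity along r. The same estimate
    yields both the convergence and, with e = 1, the membership of h in L^2.\<close>
  have bound: "L2dist2 (g n) h \<le> e" if "\<forall>m\<ge>M. L2dist2 (g n) (g m) \<le> e" for n M e
  proof -
    have "L2dist2 (g n) h = (\<integral>\<^sup>+x. liminf (\<lambda>k. ennreal ((cmod (g n x - g (r k) x))\<^sup>2)) \<partial>lebesgue)"
      unfolding L2dist2_def
    proof (rule nn_integral_cong_AE)
      show "AE x in lebesgue. ennreal ((cmod (g n x - h x))\<^sup>2) =
          liminf (\<lambda>k. ennreal ((cmod (g n x - g (r k) x))\<^sup>2))"
        using conv
      proof eventually_elim
        case (elim x)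
        then have "(\<lambda>k. g (r k) x) \<longlonglongrightarrow> h x"
          by (simp add: h_def convergent_LIMSEQ_iff)
        then have "(\<lambda>k. ennreal ((cmod (g n x - g (r k) x))\<^sup>2)) \<longlonglongrightarrow> ennreal ((cmod (g n x - h x))\<^sup>2)"
          by (intro tendsto_intros)
        from lim_imp_Liminf[OF _ this] show ?case by simp
      qed
    qed
    also have "\<dots> \<le> liminf (\<lambda>k. L2dist2 (g n) (g (r k)))"
      unfolding L2dist2_def by (rule nn_integral_liminf) measurable
    also have "\<dots> \<le> limsup (\<lambda>k. L2dist2 (g n) (g (r k)))"
      by (rule Liminf_le_Limsup) simp
    also have "\<dots> \<le> e"
    proof (rule Limsup_bounded)
      show "\<forall>\<^sub>F k in sequentially. L2dist2 (g n) (g (r k)) \<le> e"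
        using eventually_ge_at_top[of M] by eventually_elim (use that r_ge(2) order_trans in blast)
    qed
    finally show ?thesis .
  qed
  have "(\<lambda>j. L2dist2 (g j) h) \<longlonglongrightarrow> 0"
  proof (rule order_tendstoI)
    fix a :: ennreal assume "0 < a"
    then obtain b where b: "0 < b" "b < a" using dense by blast
    then obtain e where e: "0 < e" "ennreal e < a"
      by (cases b) auto
    from Cauchy[OF e(1)] obtain M where "\<forall>m\<ge>M. \<forall>n\<ge>M. L2dist2 (g m) (g n) \<le> ennreal e" by blast
    then have "\<forall>n\<ge>M. L2dist2 (g n) h \<le> ennreal e"
      using bound by blast
    with e(2) show "\<forall>\<^sub>F j in sequentially. L2dist2 (g j) h < a"
      unfolding eventually_sequentially by (meson le_less_trans)
  qed simp
  moreover have "L2 h"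
  proof -
    from Cauchy[of 1] obtain M where "\<forall>m\<ge>M. \<forall>n\<ge>M. L2dist2 (g m) (g n) \<le> ennreal 1" by auto
    then have "L2dist2 (g M) h \<le> ennreal 1"
      by (intro bound[of M]) auto
    then show ?thesis
      by (intro L2_transfer[OF g hm]) (auto simp: L2dist2_commute[of h] intro: le_less_trans)
  qed
  ultimately show ?thesis using that by blast
qed

section \<open>Approximation by truncations and extension to L^2\<close>

lemma L1_L2_dense:
  fixes u :: "'a::euclidean_space \<Rightarrow> complex"
  assumes u: "L2 u"
  obtains \<phi> where "\<And>j. L1 (\<phi> j)" "\<And>j. L2 (\<phi> j)" "(\<lambda>j. L2dist2 (\<phi> j) u) \<longlonglongrightarrow> 0"
proof -
  note [measurable] = L2_measurable[OF u]
  define \<phi> where "\<phi> j x = indicator (ball 0 (real j)) x *\<^sub>R u x" for j x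
  have m[measurable]: "\<phi> j \<in> borel_measurable lebesgue" for j
    unfolding \<phi>_def
    by (intro borel_measurable_scaleR borel_measurable_indicator L2_measurable u) simp
  have le: "(cmod (\<phi> j x))\<^sup>2 \<le> (cmod (u x))\<^sup>2" "(cmod (\<phi> j x - u x))\<^sup>2 \<le> (cmod (u x))\<^sup>2" for j x
    by (auto simp: \<phi>_def indicator_def)
  have u2: "integrable lebesgue (\<lambda>x. (cmod (u x))\<^sup>2)"
    using u by (simp add: L2_def)
  have "L1 (\<phi> j)" for j
    unfolding L1_def
  proof (rule Bochner_Integration.integrable_bound[OF _ m])
    show "integrable lebesgue (\<lambda>x. (cmod (u x))\<^sup>2 + indicator (ball 0 (real j)) x)"
      by (intro Bochner_Integration.integrable_add u2 integrable_real_indicator)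
        (auto simp: emeasure_lborel_ball_finite[unfolded infinity_ennreal_def])
    \<comment> \<open>On a ball, which has finite measure, this makes |u| \<le> |u|^2 + 1
      integrable.\<close>
    have "t \<le> t\<^sup>2 + 1" for t :: real
      using sum_squares_bound[of t 1] zero_le_power2[of t] unfolding power_one mult_1_right
      by linarith
    then show "AE x in lebesgue. norm (\<phi> j x) \<le> norm ((cmod (u x))\<^sup>2 + indicator (ball 0 (real j)) x)"
      by (auto simp: \<phi>_def indicator_def)
  qed
  moreover have "L2 (\<phi> j)" for j
    unfolding L2_def
    by (intro conjI m Bochner_Integration.integrable_bound[OF u2]) (auto simp: le)
  moreover have "(\<lambda>j. L2dist2 (\<phi> j) u) \<longlonglongrightarrow> integral\<^sup>N lebesgue (\<lambda>x::'a. 0)"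
    unfolding L2dist2_def
  proof (rule nn_integral_dominated_convergence[where w="\<lambda>x. ennreal ((cmod (u x))\<^sup>2)"])
    show "(\<integral>\<^sup>+x. ennreal ((cmod (u x))\<^sup>2) \<partial>lebesgue) < \<infinity>"
      using u by (simp add: L2_iff L2dist2_def)
    show "AE x in lebesgue. (\<lambda>j. ennreal ((cmod (\<phi> j x - u x))\<^sup>2)) \<longlonglongrightarrow> 0"
    proof (rule AE_I2)
      fix x :: 'a
      obtain n where n: "norm x < real n" using reals_Archimedean2 by blast
      have "\<forall>\<^sub>F j in sequentially. ennreal ((cmod (\<phi> j x - u x))\<^sup>2) = 0"
        using eventually_ge_at_top[of n] by eventually_elim (use n in \<open>auto simp: \<phi>_def\<close>)
      then show "(\<lambda>j. ennreal ((cmod (\<phi> j x - u x))\<^sup>2)) \<longlonglongrightarrow> 0"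
        by (rule tendsto_eventually)
    qed
  qed (auto simp: le intro!: ennreal_leI)
  ultimately show ?thesis using that[of \<phi>] by simp
qed

text \<open>The choice behind \<open>fourier_L2\<close> and \<open>ifourier_L2\<close> with the
  operator as a parameter, so that one argument serves both.\<close>

definition L2_ext :: "(('a::euclidean_space \<Rightarrow> complex) \<Rightarrow> 'a \<Rightarrow> complex) \<Rightarrow> ('a \<Rightarrow> complex) \<Rightarrow> 'a \<Rightarrow> complex" where
  "L2_ext T u = (SOME g. L2 g \<and> (\<exists>\<phi>. (\<forall>j. L1 (\<phi> j) \<and> L2 (\<phi> j)) \<and>
      (\<lambda>j. L2dist2 (\<phi> j) u) \<longlonglongrightarrow> 0 \<and> (\<lambda>j. L2dist2 (T (\<phi> j)) g) \<longlonglongrightarrow> 0))"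

lemma fourier_L2_eq: "fourier_L2 = L2_ext fourier"
  by (intro ext) (simp add: fourier_L2_def L2_ext_def)

lemma ifourier_L2_eq: "ifourier_L2 = L2_ext ifourier"
  by (intro ext) (simp add: ifourier_L2_def L2_ext_def)

text \<open>A bound on differences expresses both boundedness and the effect of linearity: it makes
  images of Cauchy sequences Cauchy.\<close>

locale L2_bounded =
  fixes T :: "('a::euclidean_space \<Rightarrow> complex) \<Rightarrow> 'a \<Rightarrow> complex" and C :: real
  assumes T_L2: "\<And>u. L1 u \<Longrightarrow> L2 u \<Longrightarrow> L2 (T u)"
    and T_bound: "\<And>u v. L1 u \<Longrightarrow> L2 u \<Longrightarrow> L1 v \<Longrightarrow> L2 v \<Longrightarrow>
      L2dist2 (T u) (T v) \<le> ennreal C * L2dist2 u v"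
begin

text \<open>A witness for the choice: truncations converge to u, \<open>T_bound\<close> makes their
  images Cauchy, and completeness supplies the limit. The chosen function may belong to another
  approximating sequence, hence the existential in the conclusion.\<close>

lemma L2_ext_spec:
  assumes u: "L2 u"
  shows "L2 (L2_ext T u) \<and> (\<exists>\<phi>. (\<forall>j. L1 (\<phi> j) \<and> L2 (\<phi> j)) \<and>
      (\<lambda>j. L2dist2 (\<phi> j) u) \<longlonglongrightarrow> 0 \<and> (\<lambda>j. L2dist2 (T (\<phi> j)) (L2_ext T u)) \<longlonglongrightarrow> 0)"
proof -
  obtain \<phi> where \<phi>: "\<And>j. L1 (\<phi> j)" "\<And>j. L2 (\<phi> j)" "(\<lambda>j. L2dist2 (\<phi> j) u) \<longlonglongrightarrow> 0"
    by (rule L1_L2_dense[OF u]) blast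
  have "\<exists>N. \<forall>m\<ge>N. \<forall>n\<ge>N. L2dist2 (T (\<phi> m)) (T (\<phi> n)) \<le> ennreal e" if "e > 0" for e
  proof -
    have "(\<lambda>j. ennreal C * (2 * L2dist2 (\<phi> j) u)) \<longlonglongrightarrow> ennreal C * (2 * 0)"
      by (intro ennreal_tendsto_cmult \<phi>) auto
    then have "\<forall>\<^sub>F j in sequentially. ennreal C * (2 * L2dist2 (\<phi> j) u) < ennreal (e / 2)"
      by (rule order_tendstoD) (use \<open>e > 0\<close> in simp)
    then obtain N where N: "\<And>j. j \<ge> N \<Longrightarrow> ennreal C * (2 * L2dist2 (\<phi> j) u) < ennreal (e / 2)"
      by (auto simp: eventually_sequentially)
    have "L2dist2 (T (\<phi> m)) (T (\<phi> n)) \<le> ennreal e" if "m \<ge> N" "n \<ge> N" for m n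
    proof -
      have "L2dist2 (T (\<phi> m)) (T (\<phi> n)) \<le> ennreal C * L2dist2 (\<phi> m) (\<phi> n)"
        by (intro T_bound \<phi>)
      also have "\<dots> \<le> ennreal C * (2 * L2dist2 (\<phi> m) u + 2 * L2dist2 u (\<phi> n))"
        by (intro mult_left_mono L2dist2_triangle L2_measurable \<phi> u) auto
      also have "\<dots> = ennreal C * (2 * L2dist2 (\<phi> m) u) + ennreal C * (2 * L2dist2 (\<phi> n) u)"
        by (simp add: L2dist2_commute[of u] distrib_left)
      also have "\<dots> \<le> ennreal (e / 2) + ennreal (e / 2)"
        by (intro add_mono less_imp_le N that)
      also have "\<dots> = ennreal e"
        using \<open>e > 0\<close> by (simp flip: ennreal_plus)
      finally show ?thesis .
    qed
    then show ?thesis by blast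
  qed
  then obtain g where "L2 g" "(\<lambda>j. L2dist2 (T (\<phi> j)) g) \<longlonglongrightarrow> 0"
    using L2_complete[of "\<lambda>j. T (\<phi> j)"] T_L2 \<phi> by blast
  with \<phi> have "\<exists>g. L2 g \<and> (\<exists>\<phi>. (\<forall>j. L1 (\<phi> j) \<and> L2 (\<phi> j)) \<and>
      (\<lambda>j. L2dist2 (\<phi> j) u) \<longlonglongrightarrow> 0 \<and> (\<lambda>j. L2dist2 (T (\<phi> j)) g) \<longlonglongrightarrow> 0)"
    by blast
  from someI_ex[OF this] show ?thesis
    unfolding L2_ext_def .
qed

lemma L2_ext_L2: "L2 u \<Longrightarrow> L2 (L2_ext T u)"
  using L2_ext_spec by blast

text \<open>The constant 16 is 4 times 4: \<open>four\<close> is applied once to the images and once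
  to the arguments, each time with coefficient 4 on the middle term. The outer terms vanish in the
  limit.\<close>

lemma L2_ext_bound:
  assumes u: "L2 u" and v: "L2 v"
  shows "L2dist2 (L2_ext T u) (L2_ext T v) \<le> 16 * ennreal C * L2dist2 u v"
proof -
  obtain \<phi> where \<phi>: "\<And>j. L1 (\<phi> j)" "\<And>j. L2 (\<phi> j)" "(\<lambda>j. L2dist2 (\<phi> j) u) \<longlonglongrightarrow> 0"
    "(\<lambda>j. L2dist2 (T (\<phi> j)) (L2_ext T u)) \<longlonglongrightarrow> 0"
    using L2_ext_spec[OF u] by blast
  obtain \<psi> where \<psi>: "\<And>j. L1 (\<psi> j)" "\<And>j. L2 (\<psi> j)" "(\<lambda>j. L2dist2 (\<psi> j) v) \<longlonglongrightarrow> 0"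
    "(\<lambda>j. L2dist2 (T (\<psi> j)) (L2_ext T v)) \<longlonglongrightarrow> 0"
    using L2_ext_spec[OF v] by blast
  note m = L2_measurable[OF u] L2_measurable[OF v] L2_measurable[OF \<phi>(2)] L2_measurable[OF \<psi>(2)]
    L2_measurable[OF L2_ext_L2[OF u]] L2_measurable[OF L2_ext_L2[OF v]]
    L2_measurable[OF T_L2[OF \<phi>(1,2)]] L2_measurable[OF T_L2[OF \<psi>(1,2)]]
  have four: "L2dist2 a d \<le> 2 * L2dist2 b a + 4 * L2dist2 b c + 4 * L2dist2 c d"
    if "a \<in> borel_measurable lebesgue" "b \<in> borel_measurable lebesgue"
      "c \<in> borel_measurable lebesgue" "d \<in> borel_measurable lebesgue" for a b c d :: "'a \<Rightarrow> complex"
  proof -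
    have "L2dist2 a d \<le> 2 * L2dist2 a b + 2 * L2dist2 b d"
      by (intro L2dist2_triangle that)
    also have "\<dots> \<le> 2 * L2dist2 a b + 2 * (2 * L2dist2 b c + 2 * L2dist2 c d)"
      by (intro add_left_mono mult_left_mono L2dist2_triangle that) auto
    finally show ?thesis
      by (simp add: L2dist2_commute[of a] distrib_left add.assoc mult.assoc[symmetric])
  qed
  have "L2dist2 (L2_ext T u) (L2_ext T v) \<le>
     2 * L2dist2 (T (\<phi> j)) (L2_ext T u) +
     4 * (ennreal C * (2 * L2dist2 (\<phi> j) u + 4 * L2dist2 u v + 4 * L2dist2 (\<psi> j) v))
     + 4 * L2dist2 (T (\<psi> j)) (L2_ext T v)" for j
  proof -
    have "L2dist2 (T (\<phi> j)) (T (\<psi> j)) \<le> ennreal C * L2dist2 (\<phi> j) (\<psi> j)"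
      by (intro T_bound \<phi> \<psi>)
    also have "\<dots> \<le> ennreal C * (2 * L2dist2 (\<phi> j) u + 4 * L2dist2 u v + 4 * L2dist2 (\<psi> j) v)"
      using four[OF m(3) m(1) m(2) m(4), of j j]
      by (intro mult_left_mono) (auto simp: L2dist2_commute[of u "\<phi> j"] L2dist2_commute[of v "\<psi> j"])
    finally show ?thesis
      by (intro order_trans[OF four[OF m(5) m(7) m(8) m(6), of j j]] add_mono mult_left_mono) auto
  qed
  moreover have "(\<lambda>j. 2 * L2dist2 (T (\<phi> j)) (L2_ext T u) +
     4 * (ennreal C * (2 * L2dist2 (\<phi> j) u + 4 * L2dist2 u v + 4 * L2dist2 (\<psi> j) v))
     + 4 * L2dist2 (T (\<psi> j)) (L2_ext T v)) \<longlonglongrightarrow>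
    2 * 0 + 4 * (ennreal C * (2 * 0 + 4 * L2dist2 u v + 4 * 0)) + 4 * 0"
    by (intro tendsto_add ennreal_tendsto_cmult tendsto_const \<phi> \<psi>) auto
  ultimately have "L2dist2 (L2_ext T u) (L2_ext T v) \<le>
      2 * 0 + 4 * (ennreal C * (2 * 0 + 4 * L2dist2 u v + 4 * 0)) + 4 * 0"
    by (intro LIMSEQ_le_const) auto
  also have "\<dots> = (4 * 4) * ennreal C * L2dist2 u v"
    by (simp only: mult_zero_right add_0_left add_0_right) (simp only: mult_ac)
  finally show ?thesis by simp
qed

text \<open>Whatever sequence the choice supplies, \<open>T_bound\<close> forces its images to
  converge to T u as well, and limits in L^2 are unique almost everywhere.\<close>

lemma L2_ext_eq:
  assumes u: "L1 u" "L2 u"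
  shows "AE x in lebesgue. L2_ext T u x = T u x"
proof -
  obtain \<phi> where \<phi>: "\<And>j. L1 (\<phi> j)" "\<And>j. L2 (\<phi> j)" "(\<lambda>j. L2dist2 (\<phi> j) u) \<longlonglongrightarrow> 0"
    "(\<lambda>j. L2dist2 (T (\<phi> j)) (L2_ext T u)) \<longlonglongrightarrow> 0"
    using L2_ext_spec[OF u(2)] by blast
  have "L2dist2 (L2_ext T u) (T u) \<le> 2 * L2dist2 (T (\<phi> j)) (L2_ext T u) + 2 * (ennreal C * L2dist2 (\<phi> j) u)" for j
  proof -
    have "L2dist2 (L2_ext T u) (T u) \<le> 2 * L2dist2 (L2_ext T u) (T (\<phi> j)) + 2 * L2dist2 (T (\<phi> j)) (T u)"
      by (intro L2dist2_triangle L2_measurable T_L2 \<phi> u L2_ext_L2)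
    also have "\<dots> \<le> 2 * L2dist2 (T (\<phi> j)) (L2_ext T u) + 2 * (ennreal C * L2dist2 (\<phi> j) u)"
      by (intro add_mono mult_left_mono T_bound \<phi> u) (auto simp: L2dist2_commute[of "L2_ext T u"])
    finally show ?thesis .
  qed
  moreover have "(\<lambda>j. 2 * L2dist2 (T (\<phi> j)) (L2_ext T u) + 2 * (ennreal C * L2dist2 (\<phi> j) u))
      \<longlonglongrightarrow> 2 * 0 + 2 * (ennreal C * 0)"
    by (intro tendsto_add ennreal_tendsto_cmult \<phi>) auto
  ultimately have "L2dist2 (L2_ext T u) (T u) \<le> 2 * 0 + 2 * (ennreal C * 0)"
    by (intro LIMSEQ_le_const) auto
  then have "L2dist2 (L2_ext T u) (T u) = 0" by simp
  then show ?thesis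
    by (simp add: L2dist2_eq_0_iff L2_measurable T_L2 u L2_ext_L2)
qed

end

subsection \<open>Fourier transforms of Schwartz functions\<close>

text \<open>With k the integer part of |x|, the point x lies in the ball of radius k + 1, of volume
  proportional to (k + 1)^n. The exponent n + 2 leaves the sum of 1 / (k + 1)^2; as balls replace
  annuli, n + 1 would leave the harmonic series.\<close>

lemma integrable_decay:
  "integrable lebesgue (\<lambda>x::'a::euclidean_space. inverse ((1 + norm x) ^ (DIM('a) + 2)))"
proof -
  let ?n = "DIM('a)"
  have [measurable]: "(\<lambda>x::'a. inverse ((1 + norm x) ^ (?n + 2))) \<in> borel_measurable lebesgue"
    by (rule measurable_completion) measurable
  let ?t = "\<lambda>k (x::'a). ennreal (inverse ((1 + real k) ^ (?n + 2))) * indicator (ball 0 (1 + real k)) x"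
  have cancel: "inverse (c ^ (?n + 2)) * (v * c ^ ?n) = v * inverse (c\<^sup>2)" if "c > 0" for c v :: real
    using that by (simp add: power_add power2_eq_square field_simps)
  have term_le: "f k \<le> suminf f" for f :: "nat \<Rightarrow> ennreal" and k
    using sum_le_suminf[of f "{k}"] by simp
  have "(\<integral>\<^sup>+x. ennreal (inverse ((1 + norm (x::'a)) ^ (?n + 2))) \<partial>lebesgue)
      \<le> (\<integral>\<^sup>+x. (\<Sum>k. ?t k x) \<partial>lebesgue)"
  proof (rule nn_integral_mono)
    fix x :: 'a
    define k where "k = nat \<lfloor>norm x\<rfloor>"
    have k: "real k \<le> norm x" "norm x < 1 + real k"
      unfolding k_def by (simp_all add: of_nat_nat) linarith+
    have "ennreal (inverse ((1 + norm x) ^ (?n + 2))) \<le> ?t k x"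
    proof -
      have "inverse ((1 + norm x) ^ (?n + 2)) \<le> inverse ((1 + real k) ^ (?n + 2))"
        using k by (intro le_imp_inverse_le power_mono) auto
      moreover have "x \<in> ball 0 (1 + real k)" using k by simp
      ultimately show ?thesis
        by (simp only: indicator_simps mult_1_right ennreal_leI)
    qed
    also have "\<dots> \<le> (\<Sum>k. ?t k x)"
      by (rule term_le)
    finally show "ennreal (inverse ((1 + norm x) ^ (?n + 2))) \<le> (\<Sum>k. ?t k x)" .
  qed
  also have "\<dots> = (\<Sum>k. \<integral>\<^sup>+x. ?t k x \<partial>lebesgue)"
    by (rule nn_integral_suminf) (auto intro!: borel_measurable_times_ennreal borel_measurable_indicator)
  also have "(\<lambda>k. \<integral>\<^sup>+x. ?t k x \<partial>lebesgue) = (\<lambda>k. ennreal (unit_ball_vol (real ?n) * inverse ((real (Suc k))\<^sup>2)))"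
  proof
    fix k
    have "(\<integral>\<^sup>+x. ?t k x \<partial>lebesgue) = ennreal (inverse ((1 + real k) ^ (?n + 2))) * emeasure lebesgue (ball (0::'a) (1 + real k))"
      by (rule nn_integral_cmult_indicator) simp
    also have "\<dots> = ennreal (inverse ((1 + real k) ^ (?n + 2)) * (unit_ball_vol (real ?n) * (1 + real k) ^ ?n))"
      by (simp add: emeasure_ball ennreal_mult)
    also have "inverse ((1 + real k) ^ (?n + 2)) * (unit_ball_vol (real ?n) * (1 + real k) ^ ?n)
        = unit_ball_vol (real ?n) * inverse ((real (Suc k))\<^sup>2)"
      using cancel[of "1 + real k"] by simp
    finally show "(\<integral>\<^sup>+x. ?t k x \<partial>lebesgue) = ennreal (unit_ball_vol (real ?n) * inverse ((real (Suc k))\<^sup>2))" .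
  qed
  also have "(\<Sum>k. ennreal (unit_ball_vol (real ?n) * inverse ((real (Suc k))\<^sup>2))) < \<infinity>"
  proof -
    have "summable (\<lambda>k. inverse ((real (Suc k))\<^sup>2))"
      using inverse_power_summable[of 2, where 'a=real] by (subst summable_Suc_iff) auto
    then have "summable (\<lambda>k. unit_ball_vol (real ?n) * inverse ((real (Suc k))\<^sup>2))"
      by (rule summable_mult)
    then show ?thesis
      by (subst suminf_ennreal2) auto
  qed
  finally show ?thesis
    by (simp add: integrable_iff_bounded del: add_2_eq_Suc')
qed

text \<open>What the sequel uses of a derivative of a Schwartz function: continuity gives
  measurability, and the exponent matches \<open>integrable_decay\<close>.\<close>

definition decays :: "('a::euclidean_space \<Rightarrow> complex) \<Rightarrow> bool" where
  "decays g \<longleftrightarrow> continuous_on UNIV g \<and>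
     (\<exists>A. \<forall>x. cmod (g x) \<le> A * inverse ((1 + norm x) ^ (DIM('a) + 2)))"

lemma integrable_of_decay:
  fixes g :: "'a::euclidean_space \<Rightarrow> complex"
  assumes "g \<in> borel_measurable lebesgue"
    and g: "\<And>x. cmod (g x) \<le> A * inverse ((1 + norm x) ^ (DIM('a) + 2))"
  shows "integrable lebesgue g"
proof (rule Bochner_Integration.integrable_bound)
  show "integrable lebesgue (\<lambda>x::'a. A * inverse ((1 + norm x) ^ (DIM('a) + 2)))"
    by (intro integrable_mult_right integrable_decay)
  show "AE x in lebesgue. norm (g x) \<le> norm (A * inverse ((1 + norm x) ^ (DIM('a) + 2)))"
    unfolding real_norm_def by (intro AE_I2 order_trans[OF g abs_ge_self])
qed fact

lemma decays_integrable: "decays g \<Longrightarrow> integrable lebesgue g"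
  unfolding decays_def
  by (auto intro!: integrable_of_decay measurable_completion simp: borel_measurable_continuous_onI simp del: power_Suc)

text \<open>An integrable function bounded by A satisfies |g|^2 \<le> A |g|.\<close>

lemma decays_L2: assumes "decays g" shows "L2 g"
proof -
  obtain A where A: "\<And>x. cmod (g x) \<le> A * inverse ((1 + norm x) ^ (DIM('a) + 2))"
    using assms by (auto simp: decays_def)
  have A0: "A \<ge> 0" using A[of 0] norm_ge_zero[of "g 0"] by (simp del: norm_ge_zero)
  have gA: "cmod (g x) \<le> A" for x
  proof -
    have "inverse ((1 + norm x) ^ (DIM('a) + 2)) \<le> 1"
      by (intro inverse_le_1_iff[THEN iffD2] disjI2 one_le_power) simp
    then show ?thesis using A[of x] A0 mult_left_mono order_trans by fastforce
  qed
  have int: "integrable lebesgue g" by (rule decays_integrable[OF assms])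
  note [measurable] = borel_measurable_integrable[OF int]
  have "integrable lebesgue (\<lambda>x. (cmod (g x))\<^sup>2)"
  proof (rule Bochner_Integration.integrable_bound)
    show "integrable lebesgue (\<lambda>x. A * cmod (g x))" using int by simp
    show "AE x in lebesgue. norm ((cmod (g x))\<^sup>2) \<le> norm (A * cmod (g x))"
      using A0 by (auto simp: power2_eq_square intro!: mult_right_mono gA)
  qed measurable
  then show ?thesis by (simp add: L2_def)
qed

text \<open>A step of length at most 1 changes 1 + |x| by at most a factor 2. This gives a single
  integrable majorant for all difference quotients below.\<close>

lemma decay_shift:
  fixes x b :: "'a::euclidean_space"
  assumes "norm b = 1" "0 \<le> t" "t \<le> 1"
  shows "inverse ((1 + norm (x + t *\<^sub>R b)) ^ n) \<le> 2 ^ n * inverse ((1 + norm x) ^ n)"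
proof -
  have "norm x \<le> norm (x + t *\<^sub>R b) + norm (t *\<^sub>R b)"
    using norm_triangle_ineq4[of "x + t *\<^sub>R b" "t *\<^sub>R b"] by simp
  then have "1 + norm x \<le> 2 * (1 + norm (x + t *\<^sub>R b))"
    using assms norm_ge_zero[of "x + t *\<^sub>R b"] by (simp del: norm_ge_zero)
  then have "(1 + norm x) ^ n \<le> 2 ^ n * (1 + norm (x + t *\<^sub>R b)) ^ n"
    unfolding power_mult_distrib[symmetric] by (intro power_mono) auto
  then show ?thesis
    by (simp add: field_simps add_pos_nonneg)
qed

text \<open>The sequential form is the one that dominated convergence accepts.\<close>

lemma tendsto_difference_quotient:
  fixes f :: "real \<Rightarrow> complex"
  assumes f: "(f has_vector_derivative D) (at 0)" and t: "t \<longlonglongrightarrow> 0" "\<And>k. t k > 0"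
  shows "(\<lambda>k. (f (t k) - f 0) /\<^sub>R t k) \<longlonglongrightarrow> D"
proof -
  have "((\<lambda>h. norm (f (0 + h) - f 0 - h *\<^sub>R D) / norm h) \<longlongrightarrow> 0) (at 0)"
    using f by (simp add: has_vector_derivative_def has_derivative_at)
  moreover have "filterlim t (at 0) sequentially"
    using t by (auto simp: filterlim_at intro!: always_eventually less_imp_neq[symmetric])
  ultimately have "(\<lambda>k. norm (f (0 + t k) - f 0 - t k *\<^sub>R D) / norm (t k)) \<longlonglongrightarrow> 0"
    by (rule filterlim_compose)
  moreover have "norm (f (0 + t k) - f 0 - t k *\<^sub>R D) / norm (t k) = norm ((f (t k) - f 0) /\<^sub>R t k - D)" for k
  proof -
    have "(f (t k) - f 0) /\<^sub>R t k - D = (f (0 + t k) - f 0 - t k *\<^sub>R D) /\<^sub>R t k"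
      using t(2)[of k] by (simp add: scaleR_diff_right)
    then show ?thesis
      by (simp only: norm_scaleR) (simp add: divide_inverse mult.commute)
  qed
  ultimately show ?thesis
    by (simp add: LIM_zero_iff tendsto_norm_zero_iff)
qed

text \<open>Translation replaces integration by parts. Translating g by t b multiplies its transform
  by \<open>cis (t * (b \<bullet> \<xi>))\<close>, so the difference quotient of g has transform
  (cis(t b.\<xi>) - 1) / t times that of g. As t tends to 0, dominated convergence gives the
  transform of the derivative on one side and the factor \<open>\<i> * (b \<bullet> \<xi>)\<close>
  appears on the other.\<close>

lemma fourier_partial:
  fixes g :: "'a::euclidean_space \<Rightarrow> complex"
  assumes diff: "\<And>x. g differentiable (at x)" and b: "norm b = 1"
    and g: "decays g" and h: "decays (\<lambda>x. frechet_derivative g (at x) b)"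
  shows "fourier (\<lambda>x. frechet_derivative g (at x) b) \<xi> = \<i> * (b \<bullet> \<xi>) * fourier g \<xi>"
proof -
  define h where "h = (\<lambda>x. frechet_derivative g (at x) b)"
  define w :: "'a \<Rightarrow> real" where "w x = inverse ((1 + norm x) ^ (DIM('a) + 2))" for x
  have w: "integrable lebesgue w" unfolding w_def by (rule integrable_decay)
  have h: "decays h" using assms by (simp add: h_def)
  obtain A where A: "\<And>x. cmod (g x) \<le> A * w x"
    using g by (auto simp: decays_def w_def)
  obtain B where B: "\<And>x. cmod (h x) \<le> B * w x"
    using h by (auto simp: decays_def w_def)
  have w0: "w x > 0" for x by (auto simp: w_def add_pos_nonneg)
  have A0: "A \<ge> 0" using A[of 0] w0[of 0] norm_ge_zero[of "g 0"] by (smt (verit) mult_neg_pos)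
  have B0: "B \<ge> 0" using B[of 0] w0[of 0] norm_ge_zero[of "h 0"] by (smt (verit) mult_neg_pos)
  let ?c = "2 ^ (DIM('a) + 2) :: real"
  have shift: "w (x + t *\<^sub>R b) \<le> ?c * w x" if "0 \<le> t" "t \<le> 1" for x t
    unfolding w_def using decay_shift[OF b that] .
  have [measurable]: "g \<in> borel_measurable borel" "h \<in> borel_measurable borel"
    using g h by (auto simp: decays_def intro!: borel_measurable_continuous_onI)
  have der: "((\<lambda>t. g (x + t *\<^sub>R b)) has_vector_derivative h (x + t *\<^sub>R b)) (at t)" for x t
  proof -
    have "(g has_derivative frechet_derivative g (at (x + t *\<^sub>R b))) (at (x + t *\<^sub>R b))"
      using diff frechet_derivative_works by blast
    moreover have "((\<lambda>t. x + t *\<^sub>R b) has_derivative (\<lambda>t. t *\<^sub>R b)) (at t)"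
      by (auto intro!: derivative_eq_intros)
    ultimately have "((\<lambda>t. g (x + t *\<^sub>R b)) has_derivative
        (\<lambda>s. frechet_derivative g (at (x + t *\<^sub>R b)) (s *\<^sub>R b))) (at t)"
      using has_derivative_compose by blast
    then show ?thesis
      using linear_frechet_derivative[OF diff, THEN linear_cmul]
      by (simp add: has_vector_derivative_def h_def)
  qed
  \<comment> \<open>Along the segment from x to x + t b the derivative is bounded through w at x
    alone, so the mean value inequality yields a majorant independent of t.\<close>
  have mvt: "cmod (g (x + t *\<^sub>R b) - g x) \<le> B * (?c * w x) * t" if t: "0 \<le> t" "t \<le> 1" for x t
  proof -
    have "norm (g (x + t *\<^sub>R b) - g (x + 0 *\<^sub>R b)) \<le> B * (?c * w x) * norm (t - 0)"
    proof (rule differentiable_bound[where S="{0..t}" and f'="\<lambda>s u. u *\<^sub>R h (x + s *\<^sub>R b)"])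
      fix s assume s: "s \<in> {0..t}"
      show "((\<lambda>t. g (x + t *\<^sub>R b)) has_derivative (\<lambda>u. u *\<^sub>R h (x + s *\<^sub>R b))) (at s within {0..t})"
        using der[of x s] by (simp add: has_vector_derivative_def has_derivative_at_withinI)
      have "cmod (h (x + s *\<^sub>R b)) \<le> B * (?c * w x)"
        using B[of "x + s *\<^sub>R b"] shift[of s x] s t B0
        by (meson atLeastAtMost_iff mult_left_mono order_trans)
      then show "onorm (\<lambda>u. u *\<^sub>R h (x + s *\<^sub>R b)) \<le> B * (?c * w x)"
        using B0 w0[of x]
        by (intro onorm_bound) (auto simp del: power_Suc power_add simp: mult.commute[of "\<bar>_\<bar>"]
            intro!: mult_right_mono mult_nonneg_nonneg)
    qed (use t in auto)
    then show ?thesis using t by simp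
  qed
  \<comment> \<open>Steps 1 / (k + 1) stay in (0, 1], the range of \<open>shift\<close> and
    \<open>mvt\<close>.\<close>
  define t where "t k = inverse (real (Suc k))" for k
  have t: "t k > 0" "t k \<ge> 0" "t k \<le> 1" for k
    by (auto simp: t_def field_simps)
  have tlim: "t \<longlonglongrightarrow> 0" unfolding t_def by (rule LIMSEQ_inverse_real_of_nat)
  define s where "s k x = ((g (x + t k *\<^sub>R b) - g x) /\<^sub>R t k) * cis (- (x \<bullet> \<xi>))" for k x
  have meas: "f \<in> borel_measurable borel \<Longrightarrow> f \<in> borel_measurable lebesgue" for f :: "'a \<Rightarrow> complex"
    by (rule measurable_completion) simp
  have "(\<lambda>k. \<integral>x. s k x \<partial>lebesgue) \<longlonglongrightarrow> (\<integral>x. h x * cis (- (x \<bullet> \<xi>)) \<partial>lebesgue)"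
  proof (rule integral_dominated_convergence[where w="\<lambda>x. B * (?c * w x)"])
    show "(\<lambda>x. h x * cis (- (x \<bullet> \<xi>))) \<in> borel_measurable lebesgue"
      by (rule meas) measurable
    show "s k \<in> borel_measurable lebesgue" for k
      unfolding s_def by (rule meas) measurable
    show "integrable lebesgue (\<lambda>x. B * (?c * w x))" using w by simp
    show "AE x in lebesgue. (\<lambda>k. s k x) \<longlonglongrightarrow> h x * cis (- (x \<bullet> \<xi>))"
    proof (rule AE_I2)
      fix x
      show "(\<lambda>k. s k x) \<longlonglongrightarrow> h x * cis (- (x \<bullet> \<xi>))"
        using tendsto_difference_quotient[of "\<lambda>t. g (x + t *\<^sub>R b)" "h x" t] der[of x 0] tlim t
        unfolding s_def by (intro tendsto_mult tendsto_const) simp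
    qed
    show "AE x in lebesgue. norm (s k x) \<le> B * (?c * w x)" for k
    proof (rule AE_I2)
      fix x
      have "norm (s k x) = norm (g (x + t k *\<^sub>R b) - g x) / t k"
        using t[of k] by (simp add: s_def norm_mult divide_inverse mult.commute)
      also have "\<dots> \<le> B * (?c * w x)"
        using mvt[OF t(2,3), of x k] t(1)[of k] by (simp add: pos_divide_le_eq)
      finally show "norm (s k x) \<le> B * (?c * w x)" .
    qed
  qed
  then have 1: "(\<lambda>k. \<integral>x. s k x \<partial>lebesgue) \<longlonglongrightarrow> fourier h \<xi>"
    by (simp add: fourier_def)
  have "(\<integral>x. s k x \<partial>lebesgue) = ((cis (t k * (b \<bullet> \<xi>)) - 1) /\<^sub>R t k) * fourier g \<xi>" for k
  proof -
    have int: "integrable lebesgue (\<lambda>x. g (x + t k *\<^sub>R b) * cis (- (x \<bullet> \<xi>)))"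
    proof (rule Bochner_Integration.integrable_bound)
      show "integrable lebesgue (\<lambda>x. A * (?c * w x))" using w by simp
      show "(\<lambda>x. g (x + t k *\<^sub>R b) * cis (- (x \<bullet> \<xi>))) \<in> borel_measurable lebesgue"
        by (rule meas) measurable
      show "AE x in lebesgue. norm (g (x + t k *\<^sub>R b) * cis (- (x \<bullet> \<xi>))) \<le> norm (A * (?c * w x))"
      proof (rule AE_I2)
        fix x
        have "norm (g (x + t k *\<^sub>R b)) \<le> A * (?c * w x)"
          using A[of "x + t k *\<^sub>R b"] mult_left_mono[OF shift[OF t(2,3), of x k] A0] by linarith
        then show "norm (g (x + t k *\<^sub>R b) * cis (- (x \<bullet> \<xi>))) \<le> norm (A * (?c * w x))"
          by (simp add: norm_mult)
      qed
    qed
    have "(\<integral>x. s k x \<partial>lebesgue) = ((\<integral>x. g (x + t k *\<^sub>R b) * cis (- (x \<bullet> \<xi>)) \<partial>lebesgue) - fourier g \<xi>) /\<^sub>R t k"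
      unfolding s_def fourier_def
      using int integrable_mult_cis[OF decays_integrable[OF g], of \<xi>]
      by (simp add: left_diff_distrib scaleR_diff_right[symmetric])
    also have "(\<integral>x. g (x + t k *\<^sub>R b) * cis (- (x \<bullet> \<xi>)) \<partial>lebesgue)
       = (\<integral>x. cis (t k * (b \<bullet> \<xi>)) * (g (t k *\<^sub>R b + x) * cis (- ((t k *\<^sub>R b + x) \<bullet> \<xi>))) \<partial>lebesgue)"
      by (intro Bochner_Integration.integral_cong refl)
        (simp add: mult.left_commute cis_mult inner_add_left add.commute)
    also have "\<dots> = cis (t k * (b \<bullet> \<xi>)) * fourier g \<xi>"
      unfolding integral_mult_right_zero fourier_def
      by (subst lebesgue_integral_translation[of "\<lambda>x. g x * cis (- (x \<bullet> \<xi>))"]) measurable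
    finally show ?thesis
      by (simp add: algebra_simps)
  qed
  moreover have "(\<lambda>k. ((cis (t k * (b \<bullet> \<xi>)) - 1) /\<^sub>R t k) * fourier g \<xi>) \<longlonglongrightarrow> (\<i> * (b \<bullet> \<xi>)) * fourier g \<xi>"
  proof (intro tendsto_mult tendsto_const)
    have "((\<lambda>t. cis (t * (b \<bullet> \<xi>))) has_vector_derivative \<i> * (b \<bullet> \<xi>)) (at 0)"
      unfolding cis_conv_exp of_real_mult
      by (rule has_vector_derivative_real_field) (auto intro!: derivative_eq_intros)
    from tendsto_difference_quotient[OF this tlim t(1)]
    show "(\<lambda>k. (cis (t k * (b \<bullet> \<xi>)) - 1) /\<^sub>R t k) \<longlonglongrightarrow> \<i> * (b \<bullet> \<xi>)"
      by simp
  qed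
  ultimately have "(\<lambda>k. \<integral>x. s k x \<partial>lebesgue) \<longlonglongrightarrow> \<i> * (b \<bullet> \<xi>) * fourier g \<xi>"
    by simp
  with 1 show ?thesis
    unfolding h_def by (rule LIMSEQ_unique)
qed

section \<open>Derivatives of Schwartz functions and decay of their transforms\<close>

lemma smooth_iter_differentiable:
  "smooth_fun f \<Longrightarrow> set bs \<subseteq> Basis \<Longrightarrow> iter_partial bs f differentiable (at x)"
  by (auto simp: smooth_fun_def)

lemma smooth_iter_continuous:
  "smooth_fun f \<Longrightarrow> set bs \<subseteq> Basis \<Longrightarrow> continuous_on UNIV (iter_partial bs f)"
  by (auto simp: continuous_on_eq_continuous_within
      intro!: differentiable_imp_continuous_within smooth_iter_differentiable)

lemma schwartz_iter_decays:
  fixes f :: "'a::euclidean_space \<Rightarrow> complex"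
  assumes f: "schwartz f" and bs: "set bs \<subseteq> Basis"
  shows "decays (iter_partial bs f)"
proof -
  have "bounded (range (\<lambda>x. (1 + norm x) ^ (DIM('a) + 2) * norm (iter_partial bs f x)))"
    using assms unfolding schwartz_def by blast
  then obtain A where A: "\<And>x. norm ((1 + norm x) ^ (DIM('a) + 2) * norm (iter_partial bs f x)) \<le> A"
    unfolding bounded_iff by blast
  have "cmod (iter_partial bs f x) \<le> A * inverse ((1 + norm x) ^ (DIM('a) + 2))" for x
    using A[of x] by (simp add: field_simps add_pos_nonneg abs_mult del: power_Suc)
  then show ?thesis
    unfolding decays_def using smooth_iter_continuous[OF _ bs] f by (auto simp: schwartz_def)
qed

lemma schwartz_L1: "schwartz f \<Longrightarrow> L1 f"
  using schwartz_iter_decays[of f "[]"] by (simp add: L1_def decays_integrable)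

lemma schwartz_L2: "schwartz f \<Longrightarrow> L2 f"
  using schwartz_iter_decays[of f "[]"] by (simp add: decays_L2)

lemma fourier_iter_partial:
  assumes f: "schwartz f" and b: "b \<in> Basis"
  shows "fourier (iter_partial (replicate m b) f) \<xi> = (\<i> * (b \<bullet> \<xi>)) ^ m * fourier f \<xi>"
proof (induction m)
  case (Suc m)
  have sub: "set (replicate m b) \<subseteq> Basis" "set (replicate (Suc m) b) \<subseteq> Basis"
    using b by auto
  have "fourier (iter_partial (replicate (Suc m) b) f) \<xi>
      = \<i> * (b \<bullet> \<xi>) * fourier (iter_partial (replicate m b) f) \<xi>"
    using fourier_partial[of "iter_partial (replicate m b) f" b \<xi>] b f
      schwartz_iter_decays[OF f sub(1)] schwartz_iter_decays[OF f sub(2)]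
      smooth_iter_differentiable[OF _ sub(1), of f]
    by (simp add: schwartz_def)
  then show ?case using Suc.IH by simp
qed simp

text \<open>The largest coordinate of \<xi> controls its norm up to the factor n, so pure
  derivatives in that direction suffice: the k-th power of the coordinate times |F f| is at most the
  L^1 norm of the k-th derivative.\<close>

lemma fourier_schwartz_decay:
  fixes f :: "'a::euclidean_space \<Rightarrow> complex"
  assumes f: "schwartz f"
  obtains A where "\<And>\<xi>. cmod (fourier f \<xi>) \<le> A * inverse ((1 + norm \<xi>) ^ k)"
proof -
  define B where "B m b = (\<integral>x. cmod (iter_partial (replicate m b) f x) \<partial>lebesgue)" for m b
  have B: "\<bar>b \<bullet> \<xi>\<bar> ^ m * cmod (fourier f \<xi>) \<le> B m b" if "b \<in> Basis" for m b \<xi>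
    using norm_fourier_le[of "iter_partial (replicate m b) f" \<xi>]
    by (simp add: fourier_iter_partial[OF f that] B_def norm_mult norm_power)
  have B0: "B m b \<ge> 0" for m b by (simp add: B_def)
  let ?d = "real DIM('a)"
  \<comment> \<open>The direction b depends on \<xi>; summing over the whole basis makes the
    constant uniform.\<close>
  define A where "A = (\<Sum>b\<in>(Basis::'a set). 2 ^ k * (B 0 b + ?d ^ k * B k b))"
  have "(1 + norm \<xi>) ^ k * cmod (fourier f \<xi>) \<le> A" for \<xi>
  proof -
    obtain b :: 'a where b: "b \<in> Basis" "\<And>c. c \<in> Basis \<Longrightarrow> \<bar>c \<bullet> \<xi>\<bar> \<le> \<bar>b \<bullet> \<xi>\<bar>"
    proof -
      have "Max ((\<lambda>b. \<bar>b \<bullet> \<xi>\<bar>) ` Basis) \<in> (\<lambda>b. \<bar>b \<bullet> \<xi>\<bar>) ` Basis"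
        by (rule Max_in) auto
      then obtain b where b: "b \<in> Basis" "Max ((\<lambda>b. \<bar>b \<bullet> \<xi>\<bar>) ` Basis) = \<bar>b \<bullet> \<xi>\<bar>"
        by (rule imageE)
      show ?thesis by (rule that[OF b(1)]) (simp flip: b(2))
    qed
    have "norm \<xi> \<le> (\<Sum>c\<in>Basis. \<bar>\<xi> \<bullet> c\<bar>)" by (rule norm_le_l1)
    also have "\<dots> \<le> ?d * \<bar>b \<bullet> \<xi>\<bar>"
      using sum_bounded_above[of "Basis::'a set" "\<lambda>c. \<bar>\<xi> \<bullet> c\<bar>" "\<bar>b \<bullet> \<xi>\<bar>"] b
      by (simp add: inner_commute)
    finally have le: "norm \<xi> \<le> ?d * \<bar>b \<bullet> \<xi>\<bar>" .
    have "(1 + norm \<xi>) ^ k \<le> (2 * max 1 (?d * \<bar>b \<bullet> \<xi>\<bar>)) ^ k"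
      using le by (intro power_mono) auto
    also have "\<dots> = 2 ^ k * max 1 (?d * \<bar>b \<bullet> \<xi>\<bar>) ^ k" by (simp add: power_mult_distrib)
    also have "\<dots> \<le> 2 ^ k * (1 + ?d ^ k * \<bar>b \<bullet> \<xi>\<bar> ^ k)"
      by (intro mult_left_mono) (auto simp: max_def power_mult_distrib)
    finally have "(1 + norm \<xi>) ^ k * cmod (fourier f \<xi>)
        \<le> 2 ^ k * (1 + ?d ^ k * \<bar>b \<bullet> \<xi>\<bar> ^ k) * cmod (fourier f \<xi>)"
      by (intro mult_right_mono) auto
    also have "\<dots> = 2 ^ k * (\<bar>b \<bullet> \<xi>\<bar> ^ 0 * cmod (fourier f \<xi>) + ?d ^ k * (\<bar>b \<bullet> \<xi>\<bar> ^ k * cmod (fourier f \<xi>)))"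
      by (simp add: algebra_simps)
    also have "\<dots> \<le> 2 ^ k * (B 0 b + ?d ^ k * B k b)"
      by (intro mult_left_mono add_mono B b) auto
    also have "\<dots> \<le> A"
      unfolding A_def by (rule member_le_sum) (auto simp: b B0)
    finally show ?thesis .
  qed
  then have "cmod (fourier f \<xi>) \<le> A * inverse ((1 + norm \<xi>) ^ k)" for \<xi>
    by (simp add: field_simps add_pos_nonneg)
  then show ?thesis by (rule that)
qed

text \<open>Makes a F u integrable for bounded a, so that \<open>ifourier\<close> and
  \<open>ifourier_L2\<close> can be identified on it.\<close>

lemma fourier_schwartz_L1:
  fixes f :: "'a::euclidean_space \<Rightarrow> complex"
  assumes f: "schwartz f"
  shows "L1 (fourier f)"
proof -
  obtain A where A: "\<And>\<xi>. cmod (fourier f \<xi>) \<le> A * inverse ((1 + norm \<xi>) ^ (DIM('a) + 2))"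
    by (rule fourier_schwartz_decay[OF f]) blast
  show ?thesis
    unfolding L1_def
    by (rule integrable_of_decay[OF fourier_measurable A]) (intro L2_measurable schwartz_L2 f)
qed

section \<open>Test functions are Schwartz functions\<close>

lemma iter_partial_eq_0:
  fixes f :: "'a::euclidean_space \<Rightarrow> complex"
  assumes "open U" "\<And>x. x \<in> U \<Longrightarrow> f x = 0" "x \<in> U"
  shows "iter_partial bs f x = 0"
  using assms(3)
proof (induction bs arbitrary: x)
  case (Cons b bs)
  have "((\<lambda>_. 0) has_derivative (\<lambda>_. 0)) (at x)" by simp
  \<comment> \<open>The derivative at x sees only the open set U, on which the previous iterate
    vanishes by induction.\<close>
  then have "(iter_partial bs f has_derivative (\<lambda>_. 0)) (at x)"
    by (rule has_derivative_transform_within_open[OF _ assms(1) Cons.prems]) (simp add: Cons.IH)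
  from frechet_derivative_at[OF this] show ?case
    by (metis iter_partial.simps(2))
qed (simp add: assms(2))

text \<open>All iterated partials vanish off the closed support, and on this compact set the
  weighted derivative is continuous, hence bounded.\<close>

lemma C0_infty_schwartz:
  fixes f :: "'a::euclidean_space \<Rightarrow> complex"
  assumes f: "C0_infty f"
  shows "schwartz f"
  unfolding schwartz_def
proof safe
  show sm: "smooth_fun f" using f by (simp add: C0_infty_def)
  fix bs :: "'a list" and k assume bs: "set bs \<subseteq> Basis"
  define K where "K = closure {x. f x \<noteq> 0}"
  have K: "compact K" using f by (simp add: C0_infty_def K_def)
  let ?F = "\<lambda>x. (1 + norm x) ^ k * norm (iter_partial bs f x)"
  have "continuous_on K ?F"
    by (intro continuous_intros continuous_on_subset[OF smooth_iter_continuous[OF sm bs]]) auto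
  then have "bounded (?F ` K)"
    using K compact_continuous_image compact_imp_bounded by blast
  moreover have F0: "?F x = 0" if "x \<notin> K" for x
  proof -
    have "iter_partial bs f x = 0"
    proof (rule iter_partial_eq_0)
      show "open (- K)" unfolding K_def by (intro open_Compl closed_closure)
      show "f x = 0" if "x \<in> - K" for x
        using that closure_subset[of "{x. f x \<noteq> 0}"] by (auto simp: K_def)
    qed (use that in simp)
    then show ?thesis by simp
  qed
  have "range ?F \<subseteq> insert 0 (?F ` K)"
  proof (intro image_subsetI)
    fix x show "?F x \<in> insert 0 (?F ` K)"
    proof (cases "x \<in> K")
      case True
      then show ?thesis by (intro insertI2 imageI)
    next
      case False
      show ?thesis by (simp only: F0[OF False] insertI1)
    qed
  qed
  ultimately show "bounded (range ?F)"
    using bounded_subset bounded_insert by blast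
qed

subsection \<open>Multipliers on $L^2$ and on Banach function spaces\<close>

lemma L2_bounded_fourier:
  obtains C where "L2_bounded (fourier :: ('a::euclidean_space \<Rightarrow> complex) \<Rightarrow> 'a \<Rightarrow> complex) C"
proof -
  define I where "I = (\<integral>\<^sup>+x. ennreal (sqrt (2 * pi) ^ DIM('a) * gauss (x::'a)) \<partial>lebesgue)"
  have "integrable lebesgue (\<lambda>x::'a. sqrt (2 * pi) ^ DIM('a) * gauss x)"
    by (intro integrable_mult_right integrable_gauss)
  then have I: "I < \<infinity>"
    unfolding I_def by (subst nn_integral_eq_integral) (auto simp: less_imp_le[OF gauss_pos])
  \<comment> \<open>The quotient of the two constants in \<open>fourier_L2_bound\<close>. Its value
    is (2 pi)^n, the constant of Plancherel's identity.\<close>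
  define C where "C = enn2real I / gauss (0::'a)"
  have bound: "L2dist2 (fourier u) (\<lambda>_. 0) \<le> ennreal C * L2dist2 u (\<lambda>_. 0)" if "L1 u" for u :: "'a \<Rightarrow> complex"
  proof -
    have "ennreal (gauss (0::'a)) * L2dist2 (fourier u) (\<lambda>_. 0) \<le> I * L2dist2 u (\<lambda>_. 0)"
      using fourier_L2_bound[OF that] by (simp add: L2dist2_def I_def)
    then have "ennreal (1 / gauss (0::'a)) * (ennreal (gauss (0::'a)) * L2dist2 (fourier u) (\<lambda>_. 0))
        \<le> ennreal (1 / gauss (0::'a)) * (I * L2dist2 u (\<lambda>_. 0))"
      by (intro mult_left_mono) auto
    moreover have "ennreal (1 / gauss (0::'a)) * ennreal (gauss (0::'a)) = 1"
      using gauss_pos[of "0::'a"] by (simp flip: ennreal_mult')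
    moreover have "ennreal (1 / gauss (0::'a)) * I = ennreal C"
    proof -
      have "ennreal (1 / gauss (0::'a)) * ennreal (enn2real I) = ennreal C"
        unfolding C_def using gauss_pos[of "0::'a"] by (simp flip: ennreal_mult')
      then show ?thesis using I by simp
    qed
    ultimately show ?thesis
      by (simp add: mult.assoc[symmetric])
  qed
  have "L2_bounded (fourier :: ('a \<Rightarrow> complex) \<Rightarrow> _) C"
  proof
    fix u v :: "'a \<Rightarrow> complex" assume u: "L1 u" "L2 u"
    show "L2 (fourier u)"
      unfolding L2_iff
    proof
      show "fourier u \<in> borel_measurable lebesgue"
        by (intro fourier_measurable L2_measurable u)
      have "L2dist2 (fourier u) (\<lambda>_. 0) \<le> ennreal C * L2dist2 u (\<lambda>_. 0)" by (rule bound[OF u(1)])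
      also have "\<dots> < \<infinity>" using u(2) by (simp add: L2_iff ennreal_mult_less_top)
      finally show "L2dist2 (fourier u) (\<lambda>_. 0) < \<infinity>" .
    qed
    assume v: "L1 v" "L2 v"
    have "L2dist2 (fourier u) (fourier v) = L2dist2 (fourier (\<lambda>x. u x - v x)) (\<lambda>_. 0)"
      using u v by (simp add: L2dist2_def fourier_diff L1_def)
    also have "\<dots> \<le> ennreal C * L2dist2 (\<lambda>x. u x - v x) (\<lambda>_. 0)"
      using u v by (intro bound) (simp add: L1_def)
    finally show "L2dist2 (fourier u) (fourier v) \<le> ennreal C * L2dist2 u v"
      by (simp add: L2dist2_def)
  qed
  then show ?thesis by (rule that)
qed

text \<open>Conjugation preserves L^2 distances, so measurability and bounds pass from
  \<open>fourier\<close> to \<open>ifourier\<close>.\<close>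

lemma ifourier_eq_fourier:
  fixes v :: "'a::euclidean_space \<Rightarrow> complex"
  shows "ifourier v x = of_real (1 / (2 * pi) ^ DIM('a)) * cnj (fourier (\<lambda>\<xi>. cnj (v \<xi>)) x)"
  unfolding ifourier_def fourier_def
  by (simp add: cis_cnj inner_commute flip: Bochner_Integration.integral_cnj)

lemma L1_cnj: "L1 u \<Longrightarrow> L1 (\<lambda>x. cnj (u x))"
  by (simp add: L1_def)

lemma L2_cnj: "L2 u \<Longrightarrow> L2 (\<lambda>x. cnj (u x))"
  by (auto simp: L2_def)

lemma ifourier_measurable:
  assumes [measurable]: "u \<in> borel_measurable lebesgue"
  shows "ifourier u \<in> borel_measurable lebesgue"
proof -
  have [measurable]: "fourier (\<lambda>\<xi>. cnj (u \<xi>)) \<in> borel_measurable lebesgue"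
    by (rule fourier_measurable) measurable
  show ?thesis
    unfolding ifourier_eq_fourier[abs_def] by measurable
qed

lemma L2_bounded_ifourier:
  obtains C where "L2_bounded (ifourier :: ('a::euclidean_space \<Rightarrow> complex) \<Rightarrow> 'a \<Rightarrow> complex) C"
proof -
  obtain C where "L2_bounded (fourier :: ('a \<Rightarrow> complex) \<Rightarrow> _) C"
    by (rule L2_bounded_fourier)
  then interpret F: L2_bounded "fourier :: ('a \<Rightarrow> complex) \<Rightarrow> _" C .
  define c where "c = 1 / (2 * pi) ^ DIM('a)"
  have c: "c > 0" by (simp add: c_def)
  have dist: "L2dist2 (ifourier u) (ifourier v) = ennreal (c\<^sup>2) *
      L2dist2 (fourier (\<lambda>x. cnj (u x))) (fourier (\<lambda>x. cnj (v x)))"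
    if [measurable]: "u \<in> borel_measurable lebesgue" "v \<in> borel_measurable lebesgue" for u v :: "'a \<Rightarrow> complex"
  proof -
    have [measurable]: "fourier (\<lambda>x. cnj (u x)) \<in> borel_measurable lebesgue"
      "fourier (\<lambda>x. cnj (v x)) \<in> borel_measurable lebesgue"
      by (auto intro!: fourier_measurable)
    have "(cmod (ifourier u x - ifourier v x))\<^sup>2 =
       c\<^sup>2 * (cmod (fourier (\<lambda>x. cnj (u x)) x - fourier (\<lambda>x. cnj (v x)) x))\<^sup>2" for x
    proof -
      have "ifourier u x - ifourier v x = of_real c *
          cnj (fourier (\<lambda>x. cnj (u x)) x - fourier (\<lambda>x. cnj (v x)) x)"
        unfolding ifourier_eq_fourier c_def[symmetric] by (simp add: right_diff_distrib)
      then show ?thesis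
        by (simp only: norm_mult norm_of_real complex_mod_cnj power_mult_distrib power2_abs)
    qed
    then show ?thesis
      by (simp add: L2dist2_def ennreal_mult nn_integral_cmult)
  qed
  have "L2_bounded (ifourier :: ('a \<Rightarrow> complex) \<Rightarrow> _) (c\<^sup>2 * C)"
  proof
    fix u v :: "'a \<Rightarrow> complex" assume u: "L1 u" "L2 u"
    show "L2 (ifourier u)"
    proof -
      \<comment> \<open>\<open>dist\<close> speaks of differences, so finiteness of the norm is
        obtained by comparison with the transform of 0.\<close>
      have "L2dist2 (ifourier u) (ifourier (\<lambda>_. 0)) < \<infinity>"
      proof -
        have "L1 (\<lambda>x::'a. 0)" "L2 (\<lambda>x::'a. 0)" by (auto simp: L1_def L2_def)
        then have "L2dist2 (fourier (\<lambda>x. cnj (u x))) (fourier (\<lambda>x. cnj 0)) < \<infinity>"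
          using u by (intro L2dist2_finite F.T_L2 L1_cnj L2_cnj)
        then show ?thesis
          using u by (subst dist) (auto simp: L2_measurable ennreal_mult_less_top)
      qed
      moreover have "ifourier (\<lambda>_::'a. 0) = (\<lambda>_. 0)" by (auto simp: ifourier_def)
      ultimately show ?thesis
        using u by (auto simp: L2_iff intro!: ifourier_measurable)
    qed
    assume v: "L1 v" "L2 v"
    have "L2dist2 (fourier (\<lambda>x. cnj (u x))) (fourier (\<lambda>x. cnj (v x)))
        \<le> ennreal C * L2dist2 (\<lambda>x. cnj (u x)) (\<lambda>x. cnj (v x))"
      by (intro F.T_bound L1_cnj L2_cnj u v)
    also have "L2dist2 (\<lambda>x. cnj (u x)) (\<lambda>x. cnj (v x)) = L2dist2 u v"
      unfolding L2dist2_def by (simp flip: complex_cnj_diff)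
    finally show "L2dist2 (ifourier u) (ifourier v) \<le> ennreal (c\<^sup>2 * C) * L2dist2 u v"
      using u v by (simp add: dist L2_measurable ennreal_mult' mult.assoc mult_left_mono)
  qed
  then show ?thesis by (rule that)
qed

section \<open>Bounded symbols as operators on L^2\<close>

lemma Linfty_measurable: "Linfty a \<Longrightarrow> a \<in> borel_measurable lebesgue"
  by (simp add: Linfty_def)

lemma Linfty_mult_L2dist2:
  fixes a :: "'a::euclidean_space \<Rightarrow> complex"
  assumes a: "Linfty a"
  obtains A where "\<And>u v. u \<in> borel_measurable lebesgue \<Longrightarrow> v \<in> borel_measurable lebesgue \<Longrightarrow>
      L2dist2 (\<lambda>x. a x * u x) (\<lambda>x. a x * v x) \<le> ennreal A * L2dist2 u v"
proof -
  obtain A where A: "AE x in lebesgue. cmod (a x) \<le> A"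
    using a by (auto simp: Linfty_def)
  have "L2dist2 (\<lambda>x. a x * u x) (\<lambda>x. a x * v x) \<le> ennreal (A\<^sup>2) * L2dist2 u v"
    if [measurable]: "u \<in> borel_measurable lebesgue" "v \<in> borel_measurable lebesgue" for u v
  proof -
    have "L2dist2 (\<lambda>x. a x * u x) (\<lambda>x. a x * v x)
        \<le> (\<integral>\<^sup>+x. ennreal (A\<^sup>2) * ennreal ((cmod (u x - v x))\<^sup>2) \<partial>lebesgue)"
      unfolding L2dist2_def
    proof (rule nn_integral_mono_AE)
      show "AE x in lebesgue. ennreal ((cmod (a x * u x - a x * v x))\<^sup>2)
          \<le> ennreal (A\<^sup>2) * ennreal ((cmod (u x - v x))\<^sup>2)"
        using A
      proof eventually_elim
        case (elim x)
        have "(cmod (a x * u x - a x * v x))\<^sup>2 = (cmod (a x))\<^sup>2 * (cmod (u x - v x))\<^sup>2"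
          by (simp add: norm_mult power_mult_distrib flip: right_diff_distrib)
        also have "\<dots> \<le> A\<^sup>2 * (cmod (u x - v x))\<^sup>2"
          using elim by (intro mult_right_mono power_mono) auto
        finally show ?case
          by (simp add: ennreal_leI flip: ennreal_mult)
      qed
    qed
    also have "\<dots> = ennreal (A\<^sup>2) * L2dist2 u v"
      unfolding L2dist2_def by (rule nn_integral_cmult) measurable
    finally show ?thesis .
  qed
  then show ?thesis by (rule that)
qed

lemma Linfty_mult_L2:
  assumes a: "Linfty a" and u: "L2 u"
  shows "L2 (\<lambda>x. a x * u x)"
proof -
  obtain A where A: "\<And>u v. u \<in> borel_measurable lebesgue \<Longrightarrow> v \<in> borel_measurable lebesgue \<Longrightarrow>
      L2dist2 (\<lambda>x. a x * u x) (\<lambda>x. a x * v x) \<le> ennreal A * L2dist2 u v"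
    using Linfty_mult_L2dist2[OF a] by blast
  note [measurable] = Linfty_measurable[OF a] L2_measurable[OF u]
  have "L2dist2 (\<lambda>x. a x * u x) (\<lambda>x. a x * 0) \<le> ennreal A * L2dist2 u (\<lambda>_. 0)"
    by (rule A) measurable
  also have "\<dots> < \<infinity>"
    using u by (simp add: L2_iff ennreal_mult_less_top)
  finally show ?thesis by (simp add: L2_iff)
qed

definition multiplier_L2 :: "('a::euclidean_space \<Rightarrow> complex) \<Rightarrow> ('a \<Rightarrow> complex) \<Rightarrow> 'a \<Rightarrow> complex" where
  "multiplier_L2 a u = ifourier_L2 (\<lambda>\<xi>. a \<xi> * fourier_L2 u \<xi>)"

text \<open>The operator is a composition of three Lipschitz maps. The four facts are proved
  together because they share the two interpretations of \<open>L2_bounded\<close>.\<close>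

lemma multiplier_L2_props:
  fixes a :: "'a::euclidean_space \<Rightarrow> complex"
  assumes a: "Linfty a"
  shows multiplier_L2_L2: "L2 u \<Longrightarrow> L2 (multiplier_L2 a u)"
    and multiplier_L2_bound: "\<exists>C. \<forall>u v. L2 u \<longrightarrow> L2 v \<longrightarrow>
      L2dist2 (multiplier_L2 a u) (multiplier_L2 a v) \<le> ennreal C * L2dist2 u v"
    and multiplier_L2_schwartz: "schwartz u \<Longrightarrow>
      AE x in lebesgue. multiplier_L2 a u x = ifourier (\<lambda>\<xi>. a \<xi> * fourier u \<xi>) x"
    and multiplier_schwartz_measurable: "schwartz u \<Longrightarrow>
      ifourier (\<lambda>\<xi>. a \<xi> * fourier u \<xi>) \<in> borel_measurable lebesgue"
proof -
  obtain C where "L2_bounded (fourier :: ('a \<Rightarrow> complex) \<Rightarrow> _) C"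
    by (rule L2_bounded_fourier)
  then interpret F: L2_bounded "fourier :: ('a \<Rightarrow> complex) \<Rightarrow> _" C .
  obtain D where "L2_bounded (ifourier :: ('a \<Rightarrow> complex) \<Rightarrow> _) D"
    by (rule L2_bounded_ifourier)
  then interpret G: L2_bounded "ifourier :: ('a \<Rightarrow> complex) \<Rightarrow> _" D .
  note F = F.L2_ext_L2[folded fourier_L2_eq] F.L2_ext_bound[folded fourier_L2_eq]
    F.L2_ext_eq[folded fourier_L2_eq]
  note G = G.L2_ext_L2[folded ifourier_L2_eq] G.L2_ext_bound[folded ifourier_L2_eq]
    G.L2_ext_eq[folded ifourier_L2_eq]
  show L2: "L2 (multiplier_L2 a u)" if "L2 u" for u
    unfolding multiplier_L2_def using that by (intro G Linfty_mult_L2 a F)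
  obtain A where A: "\<And>u v. u \<in> borel_measurable lebesgue \<Longrightarrow> v \<in> borel_measurable lebesgue \<Longrightarrow>
      L2dist2 (\<lambda>x. a x * u x) (\<lambda>x. a x * v x) \<le> ennreal A * L2dist2 u v"
    using Linfty_mult_L2dist2[OF a] by blast
  show "\<exists>C. \<forall>u v. L2 u \<longrightarrow> L2 v \<longrightarrow>
      L2dist2 (multiplier_L2 a u) (multiplier_L2 a v) \<le> ennreal C * L2dist2 u v"
  proof -
    have "L2dist2 (multiplier_L2 a u) (multiplier_L2 a v)
        \<le> 16 * ennreal D * (ennreal A * (16 * ennreal C * L2dist2 u v))"
      if "L2 u" "L2 v" for u v
    proof -
      have "L2dist2 (multiplier_L2 a u) (multiplier_L2 a v)
        \<le> 16 * ennreal D * L2dist2 (\<lambda>x. a x * fourier_L2 u x) (\<lambda>x. a x * fourier_L2 v x)"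
        unfolding multiplier_L2_def using that by (intro G Linfty_mult_L2 a F)
      also have "\<dots> \<le> 16 * ennreal D * (ennreal A * L2dist2 (fourier_L2 u) (fourier_L2 v))"
        using that by (intro mult_left_mono A L2_measurable F) auto
      also have "\<dots> \<le> 16 * ennreal D * (ennreal A * (16 * ennreal C * L2dist2 u v))"
        using that by (intro mult_left_mono F) auto
      finally show ?thesis .
    qed
    moreover have "16 * ennreal D * (ennreal A * (16 * ennreal C * z))
        = ennreal (enn2real (16 * ennreal D * ennreal A * 16 * ennreal C)) * z" for z
    proof -
      have "16 * ennreal D * ennreal A * 16 * ennreal C < top"
        by (simp add: ennreal_mult_less_top)
      then show ?thesis by (simp add: mult.assoc)
    qed
    ultimately show ?thesis by auto
  qed
  assume u: "schwartz u"
  have 1: "L1 (\<lambda>\<xi>. a \<xi> * fourier u \<xi>)"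
  proof -
    obtain A where A: "AE x in lebesgue. cmod (a x) \<le> A"
      using a by (auto simp: Linfty_def)
    have int: "integrable lebesgue (fourier u)"
      using fourier_schwartz_L1[OF u] by (simp add: L1_def)
    note [measurable] = borel_measurable_integrable[OF int] Linfty_measurable[OF a]
    have le: "AE \<xi> in lebesgue. norm (a \<xi> * fourier u \<xi>) \<le> norm (A * cmod (fourier u \<xi>))"
      using A
    proof eventually_elim
      case (elim \<xi>)
      then have "cmod (a \<xi>) * cmod (fourier u \<xi>) \<le> \<bar>A\<bar> * cmod (fourier u \<xi>)"
        by (intro mult_right_mono) auto
      then show ?case by (simp add: norm_mult abs_mult)
    qed
    have "integrable lebesgue (\<lambda>\<xi>. A * cmod (fourier u \<xi>))" using int by simp
    then show ?thesis
      unfolding L1_def by (rule Bochner_Integration.integrable_bound[OF _ _ le]) measurable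
  qed
  have Fu: "L2 (fourier u)"
    by (intro F.T_L2 schwartz_L1 schwartz_L2 u)
  have 2: "L2 (\<lambda>\<xi>. a \<xi> * fourier u \<xi>)"
    by (intro Linfty_mult_L2 a Fu)
  show "ifourier (\<lambda>\<xi>. a \<xi> * fourier u \<xi>) \<in> borel_measurable lebesgue"
    by (intro ifourier_measurable L2_measurable 2)
  have u2: "L2 u" by (intro schwartz_L2 u)
  have "AE \<xi> in lebesgue. fourier_L2 u \<xi> = fourier u \<xi>"
    by (intro F schwartz_L1 schwartz_L2 u)
  \<comment> \<open>\<open>fourier_L2 u\<close> and \<open>fourier u\<close> agree only almost
    everywhere; distance zero is carried through \<open>ifourier_L2\<close> by its Lipschitz
    bound.\<close>
  then have "L2dist2 (\<lambda>\<xi>. a \<xi> * fourier_L2 u \<xi>) (\<lambda>\<xi>. a \<xi> * fourier u \<xi>) = 0"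
    by (subst L2dist2_eq_0_iff) (auto intro!: L2_measurable Linfty_mult_L2 a F u2 2)
  then have "L2dist2 (multiplier_L2 a u) (ifourier_L2 (\<lambda>\<xi>. a \<xi> * fourier u \<xi>)) \<le> 16 * ennreal D * 0"
    unfolding multiplier_L2_def using G(2)[OF Linfty_mult_L2[OF a F(1)[OF u2]] 2] by simp
  then have "AE x in lebesgue. multiplier_L2 a u x = ifourier_L2 (\<lambda>\<xi>. a \<xi> * fourier u \<xi>) x"
    by (subst L2dist2_eq_0_iff[symmetric]) (auto intro!: L2_measurable L2 u2 G 2)
  moreover have "AE x in lebesgue. ifourier_L2 (\<lambda>\<xi>. a \<xi> * fourier u \<xi>) x = ifourier (\<lambda>\<xi>. a \<xi> * fourier u \<xi>) x"
    by (intro G 1 2)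
  ultimately show "AE x in lebesgue. multiplier_L2 a u x = ifourier (\<lambda>\<xi>. a \<xi> * fourier u \<xi>) x"
    by eventually_elim simp
qed

lemma multiplier_L2_tendsto:
  assumes a: "Linfty a" and u: "L2 u" "\<And>j. L2 (v j)" and lim: "(\<lambda>j. L2dist2 (v j) u) \<longlonglongrightarrow> 0"
  shows "(\<lambda>j. L2dist2 (multiplier_L2 a (v j)) (multiplier_L2 a u)) \<longlonglongrightarrow> 0"
proof -
  obtain C where C: "\<And>u v. L2 u \<Longrightarrow> L2 v \<Longrightarrow>
      L2dist2 (multiplier_L2 a u) (multiplier_L2 a v) \<le> ennreal C * L2dist2 u v"
    using multiplier_L2_bound[OF a] by blast
  have "(\<lambda>j. ennreal C * L2dist2 (v j) u) \<longlonglongrightarrow> ennreal C * 0"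
    by (intro ennreal_tendsto_cmult lim) simp
  then have lim': "(\<lambda>j. ennreal C * L2dist2 (v j) u) \<longlonglongrightarrow> 0" by simp
  show ?thesis
    by (rule tendsto_sandwich[OF _ _ tendsto_const lim']) (auto intro!: always_eventually C u)
qed

section \<open>Banach function norms: Fatou property and test functions\<close>

context
  fixes \<rho> :: "('a::euclidean_space \<Rightarrow> ennreal) \<Rightarrow> ennreal"
  assumes bfn: "banach_function_norm \<rho>"
begin

lemma rho_eq_0_iff: "f \<in> borel_measurable lebesgue \<Longrightarrow> \<rho> f = 0 \<longleftrightarrow> (AE x in lebesgue. f x = 0)"
  using bfn unfolding banach_function_norm_def by blast

lemma rho_cmult: "f \<in> borel_measurable lebesgue \<Longrightarrow> c \<ge> 0 \<Longrightarrow> \<rho> (\<lambda>x. ennreal c * f x) = ennreal c * \<rho> f"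
  using bfn unfolding banach_function_norm_def by blast

lemma rho_mono:
  "f \<in> borel_measurable lebesgue \<Longrightarrow> g \<in> borel_measurable lebesgue \<Longrightarrow>
    (AE x in lebesgue. g x \<le> f x) \<Longrightarrow> \<rho> g \<le> \<rho> f"
  using bfn unfolding banach_function_norm_def by blast

lemma rho_monotone_convergence:
  "(\<And>j. fs j \<in> borel_measurable lebesgue) \<Longrightarrow> f \<in> borel_measurable lebesgue \<Longrightarrow>
    (AE x in lebesgue. incseq (\<lambda>j. fs j x) \<and> (\<lambda>j. fs j x) \<longlonglongrightarrow> f x) \<Longrightarrow>
    (\<lambda>j. \<rho> (fs j)) \<longlonglongrightarrow> \<rho> f"
  using bfn unfolding banach_function_norm_def by blast

lemma rho_indicator_finite:
  "E \<in> sets lebesgue \<Longrightarrow> emeasure lebesgue E < \<infinity> \<Longrightarrow> \<rho> (indicator E) < \<infinity>"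
  using bfn unfolding banach_function_norm_def by blast

text \<open>The tail infima \<open>h j\<close> increase to g almost everywhere, so (A3) gives the
  limit of their norms, and each lies below the norm of \<open>f j\<close> by (A2).\<close>

lemma rho_Fatou:
  assumes f: "\<And>j. f j \<in> borel_measurable lebesgue" and g: "g \<in> borel_measurable lebesgue"
    and lim: "AE x in lebesgue. (\<lambda>j. f j x) \<longlonglongrightarrow> g x"
  shows "\<rho> g \<le> liminf (\<lambda>j. \<rho> (f j))"
proof -
  define h where "h j x = (INF i\<in>{j..}. f i x)" for j x
  have h: "h j \<in> borel_measurable lebesgue" for j
    unfolding h_def by (intro borel_measurable_INF f) auto
  have "(\<lambda>j. \<rho> (h j)) \<longlonglongrightarrow> \<rho> g"
  proof (rule rho_monotone_convergence[OF h g])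
    show "AE x in lebesgue. incseq (\<lambda>j. h j x) \<and> (\<lambda>j. h j x) \<longlonglongrightarrow> g x"
      using lim
    proof eventually_elim
      case (elim x)
      have inc: "incseq (\<lambda>j. h j x)"
        unfolding h_def by (intro monoI INF_superset_mono) auto
      have "(SUP j. h j x) = liminf (\<lambda>j. f j x)"
        by (simp add: liminf_SUP_INF h_def)
      also have "\<dots> = g x"
        using lim_imp_Liminf[OF _ elim] by simp
      finally show ?case using inc LIMSEQ_SUP[OF inc] by simp
    qed
  qed
  then have "\<rho> g = liminf (\<lambda>j. \<rho> (h j))"
    using lim_imp_Liminf by (metis sequentially_bot)
  also have "\<dots> \<le> liminf (\<lambda>j. \<rho> (f j))"
    by (intro Liminf_mono always_eventually allI rho_mono f h) (auto simp: h_def intro: INF_lower)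
  finally show ?thesis .
qed

lemma Xnorm_cong_AE:
  assumes f: "f \<in> borel_measurable lebesgue" "g \<in> borel_measurable lebesgue"
    and eq: "AE x in lebesgue. f x = g x"
  shows "Xnorm \<rho> f = Xnorm \<rho> g"
  unfolding Xnorm_def
proof (rule antisym)
  note [measurable] = f
  show "\<rho> (\<lambda>x. ennreal (cmod (f x))) \<le> \<rho> (\<lambda>x. ennreal (cmod (g x)))"
    by (rule rho_mono) (measurable, use eq in eventually_elim, simp)
  show "\<rho> (\<lambda>x. ennreal (cmod (g x))) \<le> \<rho> (\<lambda>x. ennreal (cmod (f x)))"
    by (rule rho_mono) (measurable, use eq in eventually_elim, simp)
qed

lemma Xnorm_eq_0_iff:
  assumes [measurable]: "f \<in> borel_measurable lebesgue"
  shows "Xnorm \<rho> f = 0 \<longleftrightarrow> (AE x in lebesgue. f x = 0)"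
  unfolding Xnorm_def by (subst rho_eq_0_iff) (auto simp: ennreal_eq_0_iff)

text \<open>The function is dominated by a multiple of the indicator of its compact support, whose
  norm is finite by (A4). Without this the approximants would not be admissible in
  \<open>mult_norm\<close>.\<close>

lemma C0_infty_inX:
  assumes f: "C0_infty f"
  shows "inX \<rho> f"
proof -
  have sf: "schwartz f" by (rule C0_infty_schwartz[OF f])
  note [measurable] = L2_measurable[OF schwartz_L2[OF sf]]
  define K where "K = closure {x. f x \<noteq> 0}"
  have K: "compact K" using f by (simp add: C0_infty_def K_def)
  have "bounded (range (\<lambda>x. (1 + norm x) ^ 0 * norm (iter_partial [] f x)))"
    using sf unfolding schwartz_def by (metis empty_subsetI list.set(1))
  then obtain A where A: "\<And>x. cmod (f x) \<le> A"
    by (auto simp: bounded_iff)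
  have A0: "A \<ge> 0" using A norm_ge_zero order_trans by blast
  have K_sets: "K \<in> sets lebesgue" using K by (simp add: borel_compact)
  note [measurable] = K_sets
  have "Xnorm \<rho> f \<le> \<rho> (\<lambda>x. ennreal A * indicator K x)"
    unfolding Xnorm_def
  proof (rule rho_mono)
    have "cmod (f x) = 0" if "x \<notin> K" for x
      using that closure_subset[of "{x. f x \<noteq> 0}"] by (auto simp: K_def)
    then show "AE x in lebesgue. ennreal (cmod (f x)) \<le> ennreal A * indicator K x"
      by (intro AE_I2) (auto simp: indicator_def intro: ennreal_leI A)
  qed (intro borel_measurable_times_ennreal borel_measurable_indicator K_sets, auto)
  also have "\<dots> = ennreal A * \<rho> (indicator K)"
    by (rule rho_cmult) (use A0 K_sets in auto)
  also have "\<dots> < \<infinity>"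
    using rho_indicator_finite[OF K_sets] K emeasure_compact_finite[OF K] borel_compact[OF K]
    by (simp add: ennreal_mult_less_top)
  finally show ?thesis by (simp add: inX_def)
qed

section \<open>Comparison of the two multiplier norms\<close>

lemma multiplier_schwartz_Xnorm:
  assumes a: "Linfty a" and u: "schwartz u"
  shows "Xnorm \<rho> (ifourier (\<lambda>\<xi>. a \<xi> * fourier u \<xi>)) = Xnorm \<rho> (multiplier_L2 a u)"
proof (rule Xnorm_cong_AE)
  show "AE x in lebesgue. ifourier (\<lambda>\<xi>. a \<xi> * fourier u \<xi>) x = multiplier_L2 a u x"
    using multiplier_L2_schwartz[OF a u] by eventually_elim simp
qed (intro multiplier_schwartz_measurable multiplier_L2_L2 L2_measurable schwartz_L2 a u)+

text \<open>The supremum omits functions of norm zero, but approximants may be of this kind. Such a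
  u vanishes almost everywhere, and so does its image, whatever the value of
  \<open>mult_norm\<close>.\<close>

lemma multiplier_Xnorm_schwartz_le:
  assumes a: "Linfty a" and u: "schwartz u" "inX \<rho> u"
  shows "Xnorm \<rho> (multiplier_L2 a u) \<le> mult_norm \<rho> a * Xnorm \<rho> u"
proof (cases "Xnorm \<rho> u = 0")
  case False
  have "Xnorm \<rho> (multiplier_L2 a u) / Xnorm \<rho> u \<le> mult_norm \<rho> a"
    unfolding mult_norm_def multiplier_schwartz_Xnorm[OF a u(1), symmetric]
    by (rule SUP_upper) (use u False in auto)
  then have "Xnorm \<rho> (multiplier_L2 a u) / Xnorm \<rho> u * Xnorm \<rho> u \<le> mult_norm \<rho> a * Xnorm \<rho> u"
    by (rule mult_right_mono) simp
  also have "Xnorm \<rho> (multiplier_L2 a u) / Xnorm \<rho> u * Xnorm \<rho> u = Xnorm \<rho> (multiplier_L2 a u)"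
    using False u(2) by (simp add: inX_def ennreal_divide_times less_top ennreal_times_divide
        mult_divide_eq_ennreal ennreal_mult_divide_eq)
  finally show ?thesis .
next
  case True
  have u2: "L2 u" by (intro schwartz_L2 u)
  note m = L2_measurable[OF u2] L2_measurable[OF multiplier_L2_L2[OF a u2]]
  obtain C where C: "\<And>u v. L2 u \<Longrightarrow> L2 v \<Longrightarrow>
      L2dist2 (multiplier_L2 a u) (multiplier_L2 a v) \<le> ennreal C * L2dist2 u v"
    using multiplier_L2_bound[OF a] by blast
  \<comment> \<open>The Lipschitz bound compares the image of u with that of 0, and the latter is
    computed from the Schwartz formula.\<close>
  have z: "schwartz (\<lambda>_::'a. 0)"
  proof (rule C0_infty_schwartz)
    have "iter_partial bs (\<lambda>_::'a. 0) = (\<lambda>_. 0)" for bs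
      by (induction bs) auto
    then show "C0_infty (\<lambda>_::'a. 0)" by (simp add: C0_infty_def smooth_fun_def)
  qed
  have "L2dist2 u (\<lambda>_. 0) = 0"
    using True m by (simp add: Xnorm_eq_0_iff L2dist2_eq_0_iff)
  then have "L2dist2 (multiplier_L2 a u) (multiplier_L2 a (\<lambda>_. 0)) = 0"
    using C[OF u2 schwartz_L2[OF z]] by simp
  then have "AE x in lebesgue. multiplier_L2 a u x = multiplier_L2 a (\<lambda>_. 0) x"
    using m multiplier_L2_L2[OF a schwartz_L2[OF z]] by (simp add: L2dist2_eq_0_iff L2_measurable)
  with multiplier_L2_schwartz[OF a z] have "AE x in lebesgue. multiplier_L2 a u x = 0"
    by eventually_elim (simp add: fourier_def ifourier_def)
  then show ?thesis
    using m by (simp add: Xnorm_eq_0_iff[THEN iffD2])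
qed

lemma multiplier_Xnorm_le:
  assumes approx: "bounded_L2_approx \<rho>" and a: "Linfty a" "mult_norm \<rho> a < \<infinity>"
    and u: "L2 u" "inX \<rho> u"
  shows "Xnorm \<rho> (multiplier_L2 a u) \<le> mult_norm \<rho> a * Xnorm \<rho> u"
proof -
  obtain v where v: "\<And>j. C0_infty (v j)" "(\<lambda>j. L2dist2 u (v j)) \<longlonglongrightarrow> 0"
    "limsup (\<lambda>j. Xnorm \<rho> (v j)) \<le> Xnorm \<rho> u"
    using approx u unfolding bounded_L2_approx_def by blast
  have vs: "schwartz (v j)" "L2 (v j)" "inX \<rho> (v j)" for j
    using C0_infty_schwartz[OF v(1)] schwartz_L2 C0_infty_inX[OF v(1)] by auto
  let ?W = "multiplier_L2 a"
  have lim: "(\<lambda>j. L2dist2 (?W (v j)) (?W u)) \<longlonglongrightarrow> 0"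
    by (intro multiplier_L2_tendsto a u vs) (use v(2) in \<open>simp add: L2dist2_commute\<close>)
  obtain r :: "nat \<Rightarrow> nat" where r: "strict_mono r"
    "AE x in lebesgue. (\<lambda>k. ?W (v (r k)) x) \<longlonglongrightarrow> ?W u x"
    by (rule L2_AE_subseq[OF _ _ lim, OF multiplier_L2_L2[OF a(1) vs(2)] multiplier_L2_L2[OF a(1) u(1)]])
  note [measurable] = L2_measurable[OF multiplier_L2_L2[OF a(1) vs(2)]]
    L2_measurable[OF multiplier_L2_L2[OF a(1) u(1)]]
  have "Xnorm \<rho> (?W u) \<le> liminf (\<lambda>k. Xnorm \<rho> (?W (v (r k))))"
    unfolding Xnorm_def
  proof (rule rho_Fatou)
    show "AE x in lebesgue. (\<lambda>k. ennreal (cmod (?W (v (r k)) x))) \<longlonglongrightarrow> ennreal (cmod (?W u x))"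
      using r(2) by eventually_elim (intro tendsto_intros)
  qed measurable
  \<comment> \<open>The approximation property controls a limsup, so the liminf from Fatou is
    weakened before the return from the subsequence to the full sequence.\<close>
  also have "\<dots> \<le> limsup (\<lambda>k. Xnorm \<rho> (?W (v (r k))))"
    by (rule Liminf_le_Limsup) simp
  also have "\<dots> \<le> limsup (\<lambda>k. mult_norm \<rho> a * Xnorm \<rho> (v (r k)))"
    by (intro Limsup_mono always_eventually allI multiplier_Xnorm_schwartz_le a vs)
  also have "\<dots> = limsup ((\<lambda>j. mult_norm \<rho> a * Xnorm \<rho> (v j)) \<circ> r)"
    by (simp add: comp_def)
  also have "\<dots> \<le> limsup (\<lambda>j. mult_norm \<rho> a * Xnorm \<rho> (v j))"
    by (rule limsup_subseq_mono[OF r(1)])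
  \<comment> \<open>Multiplication by a finite constant is monotone and continuous on
    \<open>ennreal\<close>, so it commutes with limsup. With an infinite constant continuity fails
    at 0.\<close>
  also have "\<dots> = mult_norm \<rho> a * limsup (\<lambda>j. Xnorm \<rho> (v j))"
    using a(2)
    by (intro Limsup_compose_continuous_mono[where f="\<lambda>x. mult_norm \<rho> a * x"]
        ennreal_continuous_on_cmult continuous_on_id monoI mult_left_mono) auto
  also have "\<dots> \<le> mult_norm \<rho> a * Xnorm \<rho> u"
    by (intro mult_left_mono v) simp
  finally show ?thesis .
qed

lemma mult_norm_le_mult0_norm:
  assumes a: "Linfty a"
  shows "mult_norm \<rho> a \<le> mult0_norm \<rho> a"
  unfolding mult_norm_def mult0_norm_def multiplier_L2_def[symmetric]
proof (rule SUP_mono)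
  fix u assume "u \<in> {u. schwartz u \<and> inX \<rho> u \<and> Xnorm \<rho> u \<noteq> 0}"
  then show "\<exists>v\<in>{u. L2 u \<and> inX \<rho> u \<and> Xnorm \<rho> u \<noteq> 0}.
      Xnorm \<rho> (ifourier (\<lambda>\<xi>. a \<xi> * fourier u \<xi>)) / Xnorm \<rho> u \<le> Xnorm \<rho> (multiplier_L2 a v) / Xnorm \<rho> v"
    by (intro bexI[of _ u]) (auto simp: multiplier_schwartz_Xnorm a schwartz_L2)
qed

lemma mult0_norm_le_mult_norm:
  assumes approx: "bounded_L2_approx \<rho>" and a: "Linfty a"
  shows "mult0_norm \<rho> a \<le> mult_norm \<rho> a"
\<comment> \<open>An infinite \<open>mult_norm\<close> bounds everything; the finite case is the one
  that \<open>multiplier_Xnorm_le\<close> covers.\<close>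
proof (cases "mult_norm \<rho> a < \<infinity>")
  case True
  show ?thesis
    unfolding mult0_norm_def multiplier_L2_def[symmetric]
  proof (rule SUP_least)
    fix u assume u: "u \<in> {u. L2 u \<and> inX \<rho> u \<and> Xnorm \<rho> u \<noteq> 0}"
    have "Xnorm \<rho> (multiplier_L2 a u) / Xnorm \<rho> u \<le> mult_norm \<rho> a * Xnorm \<rho> u / Xnorm \<rho> u"
      using u by (intro divide_right_mono_ennreal multiplier_Xnorm_le approx a True) auto
    also have "\<dots> = mult_norm \<rho> a"
      using u by (intro ennreal_mult_divide_eq) (auto simp: inX_def)
    finally show "Xnorm \<rho> (multiplier_L2 a u) / Xnorm \<rho> u \<le> mult_norm \<rho> a" .
  qed
qed (simp add: not_less top_unique)

end

theorem theorem6p1: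
  fixes \<rho> :: "('a::euclidean_space \<Rightarrow> ennreal) \<Rightarrow> ennreal"
  assumes "banach_function_norm \<rho>"
    and "bounded_L2_approx \<rho>"
  shows "mult0 \<rho> = mult_Linfty \<rho> \<and> (\<forall>a \<in> mult0 \<rho>. mult_norm \<rho> a = mult0_norm \<rho> a)"
proof -
  \<comment> \<open>The equality holds in \<open>ennreal\<close> for every bounded symbol, infinite
    values included, so the equality of the two sets comes with it.\<close>
  have "mult_norm \<rho> a = mult0_norm \<rho> a" if "Linfty a" for a
    using mult_norm_le_mult0_norm[OF assms(1) that] mult0_norm_le_mult_norm[OF assms that]
    by (rule antisym)
  then show ?thesis
    by (auto simp: mult0_def mult_Linfty_def)
qed

end
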